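(* Let $X$ be a Lévy process, pick $\theta>0$ and let $T_\theta\sim\mathrm{Exp}(\theta)$ be independent of $X$. For $s\in\mathbb{R}$ define the Lévy process $X^{(s)}=(X^{(s)}_t)_{t\ge0}$ by $X^{(s)}_t:=X_t-st$. Then, for any real numbers $s_1<\dots<s_n$, the following $n+1$ random vectors are independent: $$\big(\underline\tau_{T_\theta}(X^{(s_1)}),\ \underline X^{(s_1)}_{T_\theta}+s_1\underline\tau_{T_\theta}(X^{(s_1)})\big),$$ $$\big(T_\theta-\underline\tau_{T_\theta}(X^{(s_n)}),\ X_{T_\theta}-\underline X^{(s_n)}_{T_\theta}-s_n\underline\tau_{T_\theta}(X^{(s_n)})\big),$$ and, for $i=1,\dots,n-1$, $$\big(\underline\tau_{T_\theta}(X^{(s_{i+1})})-\underline\tau_{T_\theta}(X^{(s_i)}),\ \underline X^{(s_{i+1})}_{T_\theta}-\underline X^{(s_i)}_{T_\theta}+s_{i+1}\underline\tau_{T_\theta}(X^{(s_{i+1})})-s_i\underline\tau_{T_\theta}(X^{(s_i)})\big).$$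
   Context: A Lévy process $X=(X_t)_{t\ge0}$ is real-valued with stationary independent increments and càdlàg paths, started at zero; it is assumed not identically equal to zero. $\mathrm{Exp}(\theta)$ is the exponential law with mean $1/\theta$. For a càdlàg path $x$ and $t\ge0$: $\underline x_t:=\inf_{s\le t}x_s$ and $\underline\tau_t(x):=\inf\{s\in[0,t]:\min\{x_s,x_{s-}\}=\underline x_t\}$, where $x_{s-}:=\lim_{r\uparrow s}x_r$ for $s>0$ and $x_{0-}:=x_0$. In particular $\underline X^{(s)}_{T_\theta}=\inf_{r\le T_\theta}X^{(s)}_r$. *)

theory Defs
  imports "HOL-Probability.Probability"
begin

definition cadlag :: "(real \<Rightarrow> real) \<Rightarrow> bool" where
  "cadlag x \<longleftrightarrow>
     (\<forall>t\<ge>0. (x \<longlongrightarrow> x t) (at_right t)) \<and> (\<forall>t>0. \<exists>l. (x \<longlongrightarrow> l) (at_left t))"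

definition left_limit :: "(real \<Rightarrow> real) \<Rightarrow> real \<Rightarrow> real" where
  "left_limit x t = (if t > 0 then Lim (at_left t) x else x 0)"

definition running_inf :: "(real \<Rightarrow> real) \<Rightarrow> real \<Rightarrow> real" where
  "running_inf x t = (INF r\<in>{0..t}. x r)"

definition inf_time :: "(real \<Rightarrow> real) \<Rightarrow> real \<Rightarrow> real" where
  "inf_time x t = Inf {r \<in> {0..t}. min (x r) (left_limit x r) = running_inf x t}"

definition subtract_drift :: "(real \<Rightarrow> 'a \<Rightarrow> real) \<Rightarrow> real \<Rightarrow> real \<Rightarrow> 'a \<Rightarrow> real" where
  "subtract_drift X s = (\<lambda>t \<omega>. X t \<omega> - s * t)"

text \<open>Only the values of \<open>X\<close> at nonnegative times are constrained. Paths start at zero and are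
  cadlag for every outcome, not just almost surely.\<close>

locale levy_process = prob_space M for M :: "'a measure" and X :: "real \<Rightarrow> 'a \<Rightarrow> real" +
  assumes random_variable_X: "t \<ge> 0 \<Longrightarrow> random_variable borel (X t)"
    and start_zero: "\<omega> \<in> space M \<Longrightarrow> X 0 \<omega> = 0"
    and cadlag_paths: "\<omega> \<in> space M \<Longrightarrow> cadlag (\<lambda>t. X t \<omega>)"
    and stationary_increments: "0 \<le> r \<Longrightarrow> r \<le> t \<Longrightarrow>
          distr M borel (\<lambda>\<omega>. X t \<omega> - X r \<omega>) = distr M borel (\<lambda>\<omega>. X (t - r) \<omega> - X 0 \<omega>)"
    and independent_increments: "0 \<le> u 0 \<Longrightarrow> strict_mono_on {..k::nat} u \<Longrightarrow>
          indep_vars (\<lambda>_. borel) (\<lambda>i \<omega>. X (u (Suc i)) \<omega> - X (u i) \<omega>) {..<k}"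

text \<open>The constant \<open>indep_var\<close> forces both variables to have the same value type. The following is
  its characterisation \<open>indep_var_eq\<close> with that restriction lifted.\<close>

definition (in prob_space) indep_var_het ::
    "'b measure \<Rightarrow> ('a \<Rightarrow> 'b) \<Rightarrow> 'c measure \<Rightarrow> ('a \<Rightarrow> 'c) \<Rightarrow> bool" where
  "indep_var_het S Y T Z \<longleftrightarrow> random_variable S Y \<and> random_variable T Z \<and>
     indep_set (sigma_sets (space M) {Y -` A \<inter> space M | A. A \<in> sets S})
               (sigma_sets (space M) {Z -` A \<inter> space M | A. A \<in> sets T})"

lemma (in prob_space) indep_var_het_eq_indep_var:
  "indep_var_het S Y T Z \<longleftrightarrow> indep_var S Y T Z"
  by (simp add: indep_var_het_def indep_var_eq)

end

theory Submission
  imports Defs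
begin

text \<open>
  Write \<open>C\<^sub>i\<close> for the point \<open>(\<tau>\<^sub>i, m\<^sub>i + s\<^sub>i \<tau>\<^sub>i)\<close> at which a line of slope \<open>s\<^sub>i\<close>, pushed up against the path
  from below, first touches it on \<open>[0, T]\<close>. The random vectors of the theorem are the displacements
  along \<open>(0, 0), C\<^sub>1, \<dots>, C\<^sub>n, (T, X\<^sub>T)\<close>.

  For a random walk they are independent for a combinatorial reason. Cut the walk at the
  corresponding times. The piece that starts at the \<open>i\<close>-th cut stays above the line of slope \<open>s\<^sub>i\<close>
  through its starting point and ends strictly below all of its earlier points when height is
  measured relative to slope \<open>s\<^sub>i\<^sub>+\<^sub>1\<close>. Each of these conditions involves one piece only, and since
  the slopes increase, any pieces that satisfy them can be glued to a walk whose cuts are the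
  joints (\<open>good_pieces_breakpoint\<close>). Disjoint stretches of a walk are independent with a law that
  depends on their lengths alone, and if the number of steps is geometric, then the weight \<open>q\<^sup>k\<close> of
  a total length \<open>k\<close> is the product of the weights of the lengths of the pieces. So the joint law of
  the pieces is a product (\<open>geom_mean_corner_prod\<close>).

  A Levy process observed on a grid of mesh \<open>h\<close> is such a walk, and the first grid point not
  before an independent exponential time has a geometric index. As \<open>h\<close> tends to \<open>0\<close>, the minimum over the grid
  converges to the infimum of the path (\<open>grid_minimum_tendsto\<close>), but the minimisers need to converge
  only if the path has a single one. This can fail for a given slope: a compound Poisson process has
  whole intervals of minimisers at slope \<open>0\<close>. However, the first minimiser is monotone in the slope,
  so a discontinuity argument leaves at most countably many slopes with a positive probability of
  several minimisers (\<open>countable_nonunique_slopes\<close>). Those slopes are limits of good slopes from below,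
  and the first minimiser is left-continuous in the slope (\<open>inf_time_drift_left_continuous\<close>); this is
  where it matters that \<open>\<tau>\<^sub>i\<close> is the first time rather than any other time of the minimum.

  Both limits are taken in the identity \<open>E \<Prod> F\<^sub>i(Z\<^sub>i) = \<Prod> E F\<^sub>i(Z\<^sub>i)\<close> for continuous \<open>F\<^sub>i\<close> with values in
  \<open>[0, 1]\<close>, which is equivalent to independence (\<open>indep_vars_if_continuous_test_functions\<close>).
\<close>

section \<open>Minimisers of cadlag paths\<close>

text \<open>
  Left limits are admitted because a cadlag path need not attain its infimum: it may jump up at the
  moment when it is about to reach it.
\<close>

definition argmins :: "(real \<Rightarrow> real) \<Rightarrow> real \<Rightarrow> real set" where
  "argmins x t = {r \<in> {0..t}. min (x r) (left_limit x r) = running_inf x t}"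

lemma cadlag_right: "cadlag x \<Longrightarrow> 0 \<le> t \<Longrightarrow> (x \<longlongrightarrow> x t) (at_right t)"
  by (simp add: cadlag_def)

lemma cadlag_left:
  assumes "cadlag x" "0 < t"
  shows "(x \<longlongrightarrow> left_limit x t) (at_left t)"
proof -
  obtain l where l: "(x \<longlongrightarrow> l) (at_left t)"
    using assms by (auto simp: cadlag_def)
  then have "Lim (at_left t) x = l"
    by (intro tendsto_Lim) auto
  then show ?thesis
    using l assms by (simp add: left_limit_def)
qed

lemma cadlag_drift: "cadlag x \<Longrightarrow> cadlag (\<lambda>t. x t - s * t)"
  unfolding cadlag_def
proof (intro conjI allI impI)
  assume x: "(\<forall>t\<ge>0. (x \<longlongrightarrow> x t) (at_right t)) \<and> (\<forall>t>0. \<exists>l. (x \<longlongrightarrow> l) (at_left t))"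
  fix t :: real
  show "((\<lambda>t. x t - s * t) \<longlongrightarrow> x t - s * t) (at_right t)" if "0 \<le> t"
    using x that by (auto intro!: tendsto_intros)
  show "\<exists>l. ((\<lambda>t. x t - s * t) \<longlongrightarrow> l) (at_left t)" if "0 < t"
  proof -
    obtain l where "(x \<longlongrightarrow> l) (at_left t)" using x \<open>0 < t\<close> by auto
    then have "((\<lambda>t. x t - s * t) \<longlongrightarrow> l - s * t) (at_left t)"
      by (auto intro!: tendsto_intros)
    then show ?thesis ..
  qed
qed

text \<open>
  The only limits of the path along a sequence of times tending to \<open>a\<close> are the value and the left
  limit at \<open>a\<close>, since infinitely many of the times lie on one side of \<open>a\<close> or at \<open>a\<close> itself. All
  compactness arguments for paths below go through this fact.
\<close>

lemma cadlag_subseq: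
  fixes t :: "nat \<Rightarrow> real"
  assumes x: "cadlag x" and t: "t \<longlonglongrightarrow> a" and nonneg: "\<And>k. 0 \<le> t k"
  obtains r :: "nat \<Rightarrow> nat" where "strict_mono r"
    "(\<lambda>k. x (t (r k))) \<longlonglongrightarrow> x a \<or> (\<lambda>k. x (t (r k))) \<longlonglongrightarrow> left_limit x a"
proof -
  have a: "0 \<le> a"
    using t nonneg by (simp add: LIMSEQ_le_const)
  have sub: "filterlim (\<lambda>k. t (r k)) (at a within S) sequentially"
    if "strict_mono r" "\<And>k. t (r k) \<in> S" "\<And>k. t (r k) \<noteq> a" for r and S
    using that LIMSEQ_subseq_LIMSEQ[OF t \<open>strict_mono r\<close>]
    by (auto simp: filterlim_at o_def)
  have "infinite {k. t k < a} \<or> infinite {k. a < t k} \<or> infinite {k. t k = a}"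
  proof (rule ccontr)
    assume "\<not> ?thesis"
    then have "finite ({k. t k < a} \<union> {k. a < t k} \<union> {k. t k = a})" by simp
    also have "{k. t k < a} \<union> {k. a < t k} \<union> {k. t k = a} = UNIV" by auto
    finally show False by simp
  qed
  then consider "infinite {k. t k < a}" | "infinite {k. a < t k}" | "infinite {k. t k = a}"
    by blast
  then show thesis
  proof cases
    case 1
    then obtain r :: "nat \<Rightarrow> nat" where r: "strict_mono r" "\<And>k. t (r k) < a"
      using infinite_enumerate by blast
    have "0 < a" using r(2)[of 0] nonneg[of "r 0"] by linarith
    have "filterlim (\<lambda>k. t (r k)) (at_left a) sequentially"
      using r by (intro sub) (auto simp: less_imp_neq)
    from filterlim_compose[OF cadlag_left[OF x \<open>0 < a\<close>] this]
    show ?thesis using that r(1) by blast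
  next
    case 2
    then obtain r :: "nat \<Rightarrow> nat" where r: "strict_mono r" "\<And>k. a < t (r k)"
      using infinite_enumerate by blast
    have "filterlim (\<lambda>k. t (r k)) (at_right a) sequentially"
      using r by (intro sub) (auto simp: less_imp_neq[symmetric] order.strict_implies_not_eq[symmetric])
    from filterlim_compose[OF cadlag_right[OF x a] this]
    show ?thesis using that r(1) by blast
  next
    case 3
    then obtain r :: "nat \<Rightarrow> nat" where r: "strict_mono r" "\<And>k. t (r k) = a"
      using infinite_enumerate by blast
    then show ?thesis using that[of r] by simp
  qed
qed

lemma cadlag_bdd_below:
  assumes x: "cadlag x"
  shows "bdd_below (x ` {0..T})"
proof (rule ccontr)
  assume "\<not> bdd_below (x ` {0..T})"
  then have "\<exists>r\<in>{0..T}. x r < - real k" for k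
    by (auto simp: bdd_below_def not_le)
  then obtain t where t: "\<And>k. t k \<in> {0..T}" "\<And>k. x (t k) < - real k" by metis
  have "compact {0..T}" by simp
  then obtain a q where q: "strict_mono (q :: nat \<Rightarrow> nat)" "(t \<circ> q) \<longlonglongrightarrow> a"
    using t(1) unfolding compact_def by blast
  obtain r where r: "strict_mono (r :: nat \<Rightarrow> nat)"
     and "(\<lambda>k. x ((t \<circ> q) (r k))) \<longlonglongrightarrow> x a \<or> (\<lambda>k. x ((t \<circ> q) (r k))) \<longlonglongrightarrow> left_limit x a"
    using cadlag_subseq[OF x q(2)] t(1) by auto
  then have "Bseq (\<lambda>k. x ((t \<circ> q) (r k)))"
    using convergentI convergent_imp_Bseq by blast
  then obtain K where K: "\<And>k. norm (x ((t \<circ> q) (r k))) \<le> K"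
    by (auto simp: Bseq_def)
  obtain k :: nat where k: "K < real k" using reals_Archimedean2 by blast
  have "k \<le> (q \<circ> r) k"
    by (intro seq_suble strict_mono_o q r)
  then show False
    using K[of k] t(2)[of "q (r k)"] k by (auto simp: abs_real_def)
qed

lemma running_inf_le: "cadlag x \<Longrightarrow> r \<in> {0..T} \<Longrightarrow> running_inf x T \<le> x r"
  unfolding running_inf_def by (intro cINF_lower cadlag_bdd_below)

lemma running_inf_greatest: "0 \<le> T \<Longrightarrow> (\<And>r. r \<in> {0..T} \<Longrightarrow> c \<le> x r) \<Longrightarrow> c \<le> running_inf x T"
  unfolding running_inf_def by (intro cINF_greatest) auto

lemma running_inf_approx:
  assumes "cadlag x" "0 \<le> T" "\<epsilon> > 0"
  obtains r where "r \<in> {0..T}" "x r < running_inf x T + \<epsilon>"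
proof -
  have "\<exists>r\<in>{0..T}. x r < running_inf x T + \<epsilon>"
  proof (rule ccontr)
    assume "\<not> ?thesis"
    then have "running_inf x T + \<epsilon> \<le> running_inf x T"
      using assms by (intro running_inf_greatest) (auto simp: not_less)
    then show False using assms by simp
  qed
  with that show thesis by blast
qed

lemma running_inf_le_left_limit:
  assumes x: "cadlag x" and a: "a \<in> {0..T}"
  shows "running_inf x T \<le> left_limit x a"
proof (cases "0 < a")
  case True
  have "eventually (\<lambda>r. r \<in> {0<..<a}) (at_left a)"
    using True by (intro eventually_at_leftI[of 0]) auto
  then have "eventually (\<lambda>r. running_inf x T \<le> x r) (at_left a)"
    by eventually_elim (use a in \<open>auto intro!: running_inf_le x\<close>)
  with cadlag_left[OF x True] show ?thesis
    by (intro tendsto_lowerbound) auto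
next
  case False
  then show ?thesis using a running_inf_le[OF x a] by (simp add: left_limit_def)
qed

text \<open>
  A minimiser may be realised only by a left limit; for limit arguments it is replaced by a nearby
  time with a nearly minimal value.
\<close>

lemma argmins_approx:
  assumes x: "cadlag x" and a: "a \<in> argmins x T" and e: "\<epsilon> > 0"
  obtains r where "r \<in> {0..T}" "\<bar>r - a\<bar> < \<epsilon>" "x r < running_inf x T + \<epsilon>"
proof (cases "x a = running_inf x T \<or> \<not> 0 < a")
  case True
  have "x a = running_inf x T"
    using True a by (auto simp: argmins_def left_limit_def split: if_splits)
  then show ?thesis using that[of a] a e by (auto simp: argmins_def)
next
  case False
  then have "left_limit x a = running_inf x T" "0 < a"
    using a by (auto simp: argmins_def min_def split: if_splits)
  then have lim: "(x \<longlongrightarrow> running_inf x T) (at_left a)"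
    using cadlag_left[OF x] by metis
  have 1: "eventually (\<lambda>r. x r < running_inf x T + \<epsilon>) (at_left a)"
    using lim e by (intro order_tendstoD) auto
  have 2: "eventually (\<lambda>r. r \<in> {max 0 (a - \<epsilon>)<..<a}) (at_left a)"
    using \<open>0 < a\<close> e by (intro eventually_at_leftI[of "max 0 (a - \<epsilon>)"]) auto
  have "eventually (\<lambda>r. x r < running_inf x T + \<epsilon> \<and> r \<in> {max 0 (a - \<epsilon>)<..<a}) (at_left a)"
    using 1 2 by (rule eventually_conj)
  then obtain r where "x r < running_inf x T + \<epsilon>" "r \<in> {max 0 (a - \<epsilon>)<..<a}"
    using eventually_happens'[of "at_left a"] by fastforce
  then show ?thesis using that[of r] a by (auto simp: argmins_def)
qed

text \<open>
  Conversely, times with asymptotically minimal values have no limit points in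
  \<open>[0, T]\<close> other than minimisers. The times themselves may exceed \<open>T\<close>, as grid points do.
\<close>

lemma limit_in_argmins:
  assumes x: "cadlag x" and t: "t \<longlonglongrightarrow> a" "\<And>k. 0 \<le> t k" and a: "a \<le> T"
    and lim: "(\<lambda>k. x (t k)) \<longlonglongrightarrow> running_inf x T"
  shows "a \<in> argmins x T"
proof -
  have a': "a \<in> {0..T}" using t a by (simp add: LIMSEQ_le_const)
  obtain r :: "nat \<Rightarrow> nat" where r: "strict_mono r"
    and "(\<lambda>k. x (t (r k))) \<longlonglongrightarrow> x a \<or> (\<lambda>k. x (t (r k))) \<longlonglongrightarrow> left_limit x a"
    using cadlag_subseq[OF x t] by blast
  moreover have "(\<lambda>k. x (t (r k))) \<longlonglongrightarrow> running_inf x T"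
    using LIMSEQ_subseq_LIMSEQ[OF lim r] by (simp add: o_def)
  ultimately have "x a = running_inf x T \<or> left_limit x a = running_inf x T"
    using LIMSEQ_unique by blast
  then have "min (x a) (left_limit x a) = running_inf x T"
    using running_inf_le[OF x a'] running_inf_le_left_limit[OF x a'] by auto
  then show ?thesis using a' by (simp add: argmins_def)
qed

text \<open>
  The set of minimisers is nonempty by compactness of \<open>[0, T]\<close>, and it is closed, so its infimum
  belongs to it. Both facts follow from \<open>limit_in_argmins\<close>.
\<close>

lemma inf_time_in_argmins:
  assumes x: "cadlag x" and T: "0 \<le> T"
  shows "inf_time x T \<in> argmins x T"
proof -
  let ?m = "running_inf x T"
  have ex: "\<exists>r. r \<in> {0..T} \<and> x r < ?m + inverse (real (Suc k))" for k
    using running_inf_approx[OF x T, of "inverse (real (Suc k))"] by (auto simp del: of_nat_Suc)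
  then obtain t where t: "\<And>k. t k \<in> {0..T}" "\<And>k. x (t k) < ?m + inverse (real (Suc k))"
    by metis
  have lim: "u \<longlonglongrightarrow> ?m" if "\<And>k. ?m \<le> u k" "\<And>k. u k < ?m + inverse (real (Suc k))" for u
  proof (rule tendsto_sandwich)
    show "eventually (\<lambda>k. ?m \<le> u k) sequentially"
      "eventually (\<lambda>k. u k \<le> ?m + inverse (real (Suc k))) sequentially"
      using that by (auto intro!: always_eventually less_imp_le)
    show "(\<lambda>k. ?m + inverse (real (Suc k))) \<longlonglongrightarrow> ?m"
      using tendsto_add[OF tendsto_const LIMSEQ_inverse_real_of_nat, of ?m] by simp
  qed simp
  have xt: "(\<lambda>k. x (t k)) \<longlonglongrightarrow> ?m"
    using t by (intro lim running_inf_le x) auto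
  have "compact {0..T}" by simp
  then obtain a q where q: "a \<in> {0..T}" "strict_mono (q :: nat \<Rightarrow> nat)" "(t \<circ> q) \<longlonglongrightarrow> a"
    using t(1) unfolding compact_def by blast
  have "a \<in> argmins x T"
    using LIMSEQ_subseq_LIMSEQ[OF xt q(2)] q t(1)
    by (intro limit_in_argmins[OF x q(3)]) (auto simp: o_def)
  then have ne: "argmins x T \<noteq> {}" by auto
  have bdd: "bdd_below (argmins x T)"
    by (auto simp: bdd_below_def argmins_def)
  have it: "inf_time x T = Inf (argmins x T)"
    by (simp add: inf_time_def argmins_def)
  have "\<exists>r. r \<in> {0..T} \<and> \<bar>r - Inf (argmins x T)\<bar> < 2 * inverse (real (Suc k)) \<and>
      x r < ?m + inverse (real (Suc k))" for k
  proof -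
    let ?e = "inverse (real (Suc k))"
    have e: "?e > 0" by simp
    obtain b where b: "b \<in> argmins x T" "b < Inf (argmins x T) + ?e"
      using cInf_lessD[OF ne, of "Inf (argmins x T) + ?e"] e by auto
    have "Inf (argmins x T) \<le> b" using b bdd by (intro cInf_lower)
    moreover obtain r where "r \<in> {0..T}" "\<bar>r - b\<bar> < ?e" "x r < ?m + ?e"
      using argmins_approx[OF x b(1) e] .
    ultimately show ?thesis using b(2) by (intro exI[of _ r]) auto
  qed
  then obtain u where u: "\<And>k. u k \<in> {0..T}" "\<And>k. x (u k) < ?m + inverse (real (Suc k))"
    "\<And>k. \<bar>u k - Inf (argmins x T)\<bar> < 2 * inverse (real (Suc k))" by metis
  have "(\<lambda>k. u k - Inf (argmins x T)) \<longlonglongrightarrow> 0"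
  proof (rule Lim_null_comparison)
    show "eventually (\<lambda>k. norm (u k - Inf (argmins x T)) \<le> 2 * inverse (real (Suc k))) sequentially"
      using u(3) by (auto intro!: always_eventually less_imp_le simp del: of_nat_Suc)
    show "(\<lambda>k. 2 * inverse (real (Suc k))) \<longlonglongrightarrow> 0"
      using tendsto_mult_right_zero[OF LIMSEQ_inverse_real_of_nat, of 2] by simp
  qed
  then have "u \<longlonglongrightarrow> Inf (argmins x T)" by (simp add: LIM_zero_iff)
  then show ?thesis
    unfolding it
  proof (rule limit_in_argmins[OF x])
    show "0 \<le> u k" for k using u(1)[of k] by simp
    show "Inf (argmins x T) \<le> T"
      using cInf_lower[OF \<open>a \<in> argmins x T\<close> bdd] q(1) by simp
    show "(\<lambda>k. x (u k)) \<longlonglongrightarrow> ?m"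
      using u by (intro lim running_inf_le x) auto
  qed
qed

lemma inf_time_bounds:
  assumes "cadlag x" "0 \<le> T"
  shows "0 \<le> inf_time x T" "inf_time x T \<le> T"
  using inf_time_in_argmins[OF assms] by (auto simp: argmins_def)

lemma inf_time_le: "a \<in> argmins x T \<Longrightarrow> inf_time x T \<le> a"
  unfolding inf_time_def argmins_def by (intro cInf_lower) (auto simp: bdd_below_def)

lemma running_inf_antimono:
  "cadlag x \<Longrightarrow> 0 \<le> a \<Longrightarrow> a \<le> T \<Longrightarrow> running_inf x T \<le> running_inf x a"
  by (intro running_inf_greatest running_inf_le) auto

text \<open>
  This expresses the first time of the minimum through infima alone, from which its measurability
  is read off.
\<close>

lemma inf_time_le_iff:
  assumes x: "cadlag x" and a: "0 \<le> a" and T: "0 \<le> T"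
  shows "inf_time x T \<le> a \<longleftrightarrow> running_inf x (min a T) = running_inf x T"
proof (cases "a \<le> T")
  case False
  then show ?thesis using inf_time_bounds(2)[OF x T] by simp
next
  case True
  show ?thesis
  proof
    assume "running_inf x (min a T) = running_inf x T"
    then have "running_inf x a = running_inf x T" using True by simp
    then have "inf_time x a \<in> argmins x T"
      using inf_time_in_argmins[OF x a] True by (auto simp: argmins_def)
    then show "inf_time x T \<le> a"
      using inf_time_le[of "inf_time x a" x T] inf_time_bounds(2)[OF x a] by linarith
  next
    assume le: "inf_time x T \<le> a"
    have "inf_time x T \<in> {0..a}" using le inf_time_bounds[OF x T] by simp
    then have "running_inf x a \<le> min (x (inf_time x T)) (left_limit x (inf_time x T))"
      using running_inf_le[OF x] running_inf_le_left_limit[OF x] by auto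
    also have "\<dots> = running_inf x T"
      using inf_time_in_argmins[OF x T] by (simp add: argmins_def)
    finally show "running_inf x (min a T) = running_inf x T"
      using running_inf_antimono[OF x a True] True by simp
  qed
qed

text \<open>
  Add the two inequalities that say that \<open>a\<close> is better than \<open>b\<close> for slope \<open>s\<close> and \<open>b\<close> is better than
  \<open>a\<close> for slope \<open>s'\<close>: the path cancels and \<open>(s - s') (b - a) \<le> 0\<close> remains. The proof does this for
  approximate minimisers. The conclusion holds for all minimisers, not just the first ones.
\<close>

lemma argmins_drift_mono:
  assumes x: "cadlag x" and s: "s' < s"
    and a: "a \<in> argmins (\<lambda>t. x t - s * t) T" and b: "b \<in> argmins (\<lambda>t. x t - s' * t) T"
  shows "b \<le> a"
proof (rule field_le_epsilon)
  fix e :: real assume e: "0 < e"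
  \<comment> \<open>Each of the two approximations costs at most \<open>e / 3\<close> in time, and the two errors in height together
    cost \<open>2 * \<epsilon> / (s - s') \<le> e / 3\<close>.\<close>
  define \<epsilon> where "\<epsilon> = min (e / 3) ((s - s') * e / 6)"
  have \<epsilon>: "\<epsilon> > 0" using e s by (simp add: \<epsilon>_def)
  obtain r where r: "r \<in> {0..T}" "\<bar>r - a\<bar> < \<epsilon>" "x r - s * r < running_inf (\<lambda>t. x t - s * t) T + \<epsilon>"
    using argmins_approx[OF cadlag_drift[OF x] a \<epsilon>] .
  obtain u where u: "u \<in> {0..T}" "\<bar>u - b\<bar> < \<epsilon>" "x u - s' * u < running_inf (\<lambda>t. x t - s' * t) T + \<epsilon>"
    using argmins_approx[OF cadlag_drift[OF x] b \<epsilon>] .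
  have "x r - s * r < x u - s * u + \<epsilon>"
    using r(3) running_inf_le[OF cadlag_drift[OF x] u(1), of s] by simp
  moreover have "x u - s' * u < x r - s' * r + \<epsilon>"
    using u(3) running_inf_le[OF cadlag_drift[OF x] r(1), of s'] by simp
  ultimately have "(s - s') * (u - r) < 2 * \<epsilon>" by (simp add: algebra_simps)
  also have "\<dots> \<le> (s - s') * (e / 3)" by (simp add: \<epsilon>_def min_def)
  finally have "u - r < e / 3" using s by simp
  moreover have "\<epsilon> \<le> e / 3" by (simp add: \<epsilon>_def)
  ultimately show "b \<le> a + e" using r(2) u(2) by linarith
qed

lemma running_inf_drift_lipschitz:
  assumes x: "cadlag x" and T: "0 \<le> T"
  shows "\<bar>running_inf (\<lambda>t. x t - s * t) T - running_inf (\<lambda>t. x t - s' * t) T\<bar> \<le> \<bar>s - s'\<bar> * T"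
proof -
  have *: "running_inf (\<lambda>t. x t - s * t) T - \<bar>s - s'\<bar> * T \<le> running_inf (\<lambda>t. x t - s' * t) T" for s s'
  proof (rule running_inf_greatest[OF T])
    fix r assume r: "r \<in> {0..T}"
    have "(s' - s) * r \<le> \<bar>s - s'\<bar> * T" using r by (intro mult_mono) auto
    then show "running_inf (\<lambda>t. x t - s * t) T - \<bar>s - s'\<bar> * T \<le> x r - s' * r"
      using running_inf_le[OF cadlag_drift[OF x] r, of s] by (simp add: algebra_simps)
  qed
  from *[of s s'] *[of s' s] show ?thesis by (simp add: abs_minus_commute)
qed

lemma running_inf_drift_tendsto:
  assumes x: "cadlag x" and T: "0 \<le> T" and s: "s \<longlonglongrightarrow> s0"
  shows "(\<lambda>k. running_inf (\<lambda>t. x t - s k * t) T) \<longlonglongrightarrow> running_inf (\<lambda>t. x t - s0 * t) T"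
proof -
  have "(\<lambda>k. running_inf (\<lambda>t. x t - s k * t) T - running_inf (\<lambda>t. x t - s0 * t) T) \<longlonglongrightarrow> 0"
  proof (rule Lim_null_comparison)
    show "eventually (\<lambda>k. norm (running_inf (\<lambda>t. x t - s k * t) T - running_inf (\<lambda>t. x t - s0 * t) T)
       \<le> \<bar>s k - s0\<bar> * T) sequentially"
      using running_inf_drift_lipschitz[OF x T] by (intro always_eventually) auto
    have "(\<lambda>k. \<bar>s k - s0\<bar> * T) \<longlonglongrightarrow> \<bar>s0 - s0\<bar> * T"
      by (intro tendsto_intros s)
    then show "(\<lambda>k. \<bar>s k - s0\<bar> * T) \<longlonglongrightarrow> 0" by simp
  qed
  then show ?thesis by (simp add: LIM_zero_iff)
qed

lemma bounded_LIMSEQ_if_unique_limit_point: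
  fixes t :: "nat \<Rightarrow> real"
  assumes bnd: "bounded (range t)"
    and pt: "\<And>r b. strict_mono r \<Longrightarrow> (t \<circ> r) \<longlonglongrightarrow> b \<Longrightarrow> b = a"
  shows "t \<longlonglongrightarrow> a"
proof (rule ccontr)
  assume "\<not> t \<longlonglongrightarrow> a"
  then obtain e where e: "e > 0" "\<And>N. \<exists>k\<ge>N. e \<le> dist (t k) a"
    unfolding LIMSEQ_def by (auto simp: not_less)
  then have "infinite {k. e \<le> dist (t k) a}"
    by (auto simp: infinite_nat_iff_unbounded_le)
  then obtain r :: "nat \<Rightarrow> nat" where r: "strict_mono r" "\<And>k. e \<le> dist (t (r k)) a"
    using infinite_enumerate by blast
  have "bounded (range (t \<circ> r))"
    by (rule bounded_subset[OF bnd]) auto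
  then obtain b q where q: "strict_mono q" "((t \<circ> r) \<circ> q) \<longlonglongrightarrow> b"
    using bounded_imp_convergent_subsequence by blast
  then have "b = a" using pt[of "r \<circ> q" b] r(1) by (simp add: strict_mono_o o_assoc)
  with q(2) have "(\<lambda>k. dist (t (r (q k))) a) \<longlonglongrightarrow> 0"
    by (simp add: tendsto_dist_iff[symmetric] o_def)
  then have "e \<le> 0" using r(2) by (intro LIMSEQ_le_const) auto
  then show False using e by simp
qed

text \<open>
  The upper bounds \<open>U k\<close>, which tend to \<open>T\<close>, keep the limit points of \<open>t\<close> inside \<open>[0, T]\<close>.
\<close>

lemma tendsto_unique_argmin:
  assumes x: "cadlag x" and A: "argmins x T = {a}"
    and t: "\<And>k. 0 \<le> t k" "\<And>k. t k \<le> U k" "U \<longlonglongrightarrow> T"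
    and lim: "(\<lambda>k. x (t k)) \<longlonglongrightarrow> running_inf x T"
  shows "t \<longlonglongrightarrow> a"
proof (rule bounded_LIMSEQ_if_unique_limit_point)
  obtain K where that: "\<And>k. \<bar>U k\<bar> \<le> K"
    using convergent_imp_Bseq[OF convergentI[OF t(3)]] by (auto simp: Bseq_def)
  then have "\<bar>t k\<bar> \<le> K" for k
    using t(1)[of k] t(2)[of k] that[of k] by linarith
  then show "bounded (range t)" by (auto simp: bounded_iff)
  fix r b assume r: "strict_mono r" "(t \<circ> r) \<longlonglongrightarrow> b"
  have "(U \<circ> r) \<longlonglongrightarrow> T" using LIMSEQ_subseq_LIMSEQ[OF t(3) r(1)] .
  then have "b \<le> T" using r(2) t(2) by (intro LIMSEQ_le[of "t \<circ> r" b "U \<circ> r"]) auto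
  then have "b \<in> argmins x T"
    using LIMSEQ_subseq_LIMSEQ[OF lim r(1)] t(1)
    by (intro limit_in_argmins[OF x r(2)]) (auto simp: o_def)
  then show "b = a" using A by simp
qed

lemma inf_time_drift_mono:
  assumes x: "cadlag x" and T: "0 \<le> T" and s: "s' \<le> s"
  shows "inf_time (\<lambda>t. x t - s' * t) T \<le> inf_time (\<lambda>t. x t - s * t) T"
proof (cases "s' = s")
  case False
  then have "s' < s" using s by simp
  then show ?thesis
    by (rule argmins_drift_mono[OF x _ inf_time_in_argmins[OF cadlag_drift[OF x] T]
          inf_time_in_argmins[OF cadlag_drift[OF x] T]])
qed simp

text \<open>
  A limit point of first minimisers for slopes \<open>s k \<le> s0\<close> is a minimiser for \<open>s0\<close>, and by monotonicity
  it does not lie after the first one.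
\<close>

lemma inf_time_drift_left_continuous:
  assumes x: "cadlag x" and T: "0 \<le> T" and s: "s \<longlonglongrightarrow> s0" and le: "\<And>k. s k \<le> s0"
  shows "(\<lambda>k. inf_time (\<lambda>t. x t - s k * t) T) \<longlonglongrightarrow> inf_time (\<lambda>t. x t - s0 * t) T"
proof (rule bounded_LIMSEQ_if_unique_limit_point)
  let ?y = "\<lambda>s t. x t - s * t"
  let ?\<tau> = "\<lambda>s. inf_time (?y s) T"
  note y = cadlag_drift[OF x]
  show "bounded (range (\<lambda>k. ?\<tau> (s k)))"
    using inf_time_bounds[OF y T] by (intro bounded_subset[OF bounded_closed_interval[of 0 T]]) auto
  fix r b assume r: "strict_mono r" "((\<lambda>k. ?\<tau> (s k)) \<circ> r) \<longlonglongrightarrow> b"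
  have b: "b \<le> ?\<tau> s0"
    using r(2) inf_time_drift_mono[OF x T le] by (intro LIMSEQ_le_const2) auto
  have "\<exists>u. u \<in> {0..T} \<and> \<bar>u - ?\<tau> (s k)\<bar> < inverse (real (Suc k)) \<and>
     ?y (s k) u < running_inf (?y (s k)) T + inverse (real (Suc k))" for k
  proof -
    have "inverse (real (Suc k)) > 0" by simp
    from argmins_approx[OF y inf_time_in_argmins[OF y T] this, of "s k"] show ?thesis by blast
  qed
  then obtain u where u: "\<And>k. u k \<in> {0..T}" "\<And>k. \<bar>u k - ?\<tau> (s k)\<bar> < inverse (real (Suc k))"
     "\<And>k. ?y (s k) (u k) < running_inf (?y (s k)) T + inverse (real (Suc k))" by metis
  have "(\<lambda>k. u k - ?\<tau> (s k)) \<longlonglongrightarrow> 0"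
    using u(2) by (intro Lim_null_comparison[OF _ LIMSEQ_inverse_real_of_nat])
      (auto intro!: always_eventually less_imp_le simp del: of_nat_Suc)
  from tendsto_add[OF LIMSEQ_subseq_LIMSEQ[OF this r(1)] r(2)]
  have ur: "(u \<circ> r) \<longlonglongrightarrow> b" by (simp add: o_def)
  have "(\<lambda>k. ?y (s k) (u k)) \<longlonglongrightarrow> running_inf (?y s0) T"
  proof (rule tendsto_sandwich)
    show "(\<lambda>k. running_inf (?y (s k)) T) \<longlonglongrightarrow> running_inf (?y s0) T"
      by (rule running_inf_drift_tendsto[OF x T s])
    from tendsto_add[OF this LIMSEQ_inverse_real_of_nat]
    show "(\<lambda>k. running_inf (?y (s k)) T + inverse (real (Suc k))) \<longlonglongrightarrow> running_inf (?y s0) T" by simp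
    show "eventually (\<lambda>k. running_inf (?y (s k)) T \<le> ?y (s k) (u k)) sequentially"
      using running_inf_le[OF y u(1)] by (intro always_eventually) auto
    show "eventually (\<lambda>k. ?y (s k) (u k) \<le> running_inf (?y (s k)) T + inverse (real (Suc k))) sequentially"
      using u(3) by (intro always_eventually) (auto simp del: of_nat_Suc intro: less_imp_le)
  qed
  moreover have "(\<lambda>k. (s k - s0) * u k) \<longlonglongrightarrow> 0"
  proof (rule Lim_null_comparison)
    show "eventually (\<lambda>k. norm ((s k - s0) * u k) \<le> \<bar>s k - s0\<bar> * T) sequentially"
      using u(1) by (intro always_eventually) (auto simp: abs_mult intro!: mult_left_mono)
    have "(\<lambda>k. \<bar>s k - s0\<bar> * T) \<longlonglongrightarrow> \<bar>s0 - s0\<bar> * T"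
      by (intro tendsto_intros s)
    then show "(\<lambda>k. \<bar>s k - s0\<bar> * T) \<longlonglongrightarrow> 0" by simp
  qed
  ultimately have "(\<lambda>k. ?y (s k) (u k) + (s k - s0) * u k) \<longlonglongrightarrow> running_inf (?y s0) T"
    using tendsto_add by fastforce
  then have "(\<lambda>k. ?y s0 (u k)) \<longlonglongrightarrow> running_inf (?y s0) T"
    by (simp add: algebra_simps)
  from LIMSEQ_subseq_LIMSEQ[OF this r(1)]
  have "b \<in> argmins (?y s0) T"
    using b inf_time_bounds[OF y T, of s0] u(1)
    by (intro limit_in_argmins[OF y ur]) (auto simp: o_def intro: order_trans)
  from inf_time_le[OF this] b show "b = ?\<tau> s0" by simp
qed

section \<open>Minima over grids\<close>

lemma cadlag_tendsto_from_right:
  assumes x: "cadlag x" and T: "0 \<le> T" and U: "\<And>k. T \<le> U k" "U \<longlonglongrightarrow> T"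
  shows "(\<lambda>k. x (U k)) \<longlonglongrightarrow> x T"
proof -
  have "at T within {T..} = at T within {T<..}"
    by (rule at_within_nhd[of T UNIV]) auto
  then have "continuous (at T within {T..}) x"
    using cadlag_right[OF x T] by (simp add: continuous_within)
  then show ?thesis
    using U by (simp add: continuous_within_sequentially o_def)
qed

lemma mult_ceiling:
  fixes a b :: real
  assumes "0 < b"
  shows "a \<le> b * of_int \<lceil>a / b\<rceil>" "b * of_int \<lceil>a / b\<rceil> \<le> a + b"
proof -
  have "b * (a / b) \<le> b * of_int \<lceil>a / b\<rceil>" using assms by (intro mult_left_mono) auto
  then show "a \<le> b * of_int \<lceil>a / b\<rceil>" using assms by simp
  have "b * of_int \<lceil>a / b\<rceil> \<le> b * (a / b + 1)"
    using assms by (intro mult_left_mono) linarith+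
  then show "b * of_int \<lceil>a / b\<rceil> \<le> a + b" using assms by (simp add: distrib_left)
qed

text \<open>
  The last grid point \<open>h N * K N\<close> may lie beyond \<open>T\<close>, where the path can be lower than its infimum over
  \<open>[0, T]\<close>; right-continuity at \<open>T\<close> bounds the error. In the other direction, a nearly minimal time \<open>r\<close>
  is rounded up to the grid, and right-continuity at \<open>r\<close> applies.
\<close>

lemma grid_minimum_tendsto:
  fixes K J :: "nat \<Rightarrow> nat" and h :: "nat \<Rightarrow> real" and T :: real
  assumes x: "cadlag x" and T: "0 \<le> T" and h: "\<And>N. h N > 0" "h \<longlonglongrightarrow> 0"
    and K: "\<And>N. T \<le> h N * K N" "\<And>N. h N * K N \<le> T + h N"
    and J: "\<And>N. J N \<le> K N" "\<And>N r. r \<le> K N \<Longrightarrow> x (h N * J N) \<le> x (h N * real r)"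
  shows "(\<lambda>N. x (h N * J N)) \<longlonglongrightarrow> running_inf x T"
proof (rule order_tendstoI)
  let ?m = "running_inf x T"
  fix c assume "c < ?m"
  then have "c < x T" using running_inf_le[OF x, of T T] T by simp
  then have "eventually (\<lambda>t. c < x t) (at_right T)"
    by (rule order_tendstoD(1)[OF cadlag_right[OF x T]])
  then obtain b where b: "b > T" "\<And>t. T < t \<Longrightarrow> t < b \<Longrightarrow> c < x t"
    by (auto simp: eventually_at_right_field)
  have "(\<lambda>N. T + h N) \<longlonglongrightarrow> T + 0" by (intro tendsto_intros h)
  then have "eventually (\<lambda>N. T + h N < b) sequentially"
    using b by (auto dest: order_tendstoD)
  then show "eventually (\<lambda>N. c < x (h N * J N)) sequentially"
  proof eventually_elim
    case (elim N)
    have "h N * J N \<le> h N * K N" using h(1)[of N] J(1)[of N] by (intro mult_left_mono) auto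
    then have "h N * J N < b" using elim K(2)[of N] by simp
    show ?case
    proof (cases "h N * J N \<le> T")
      case True
      then have "?m \<le> x (h N * J N)" using h(1)[of N] by (intro running_inf_le x) simp
      then show ?thesis using \<open>c < ?m\<close> by simp
    next
      case False
      then show ?thesis using b \<open>h N * J N < b\<close> by simp
    qed
  qed
next
  let ?m = "running_inf x T"
  fix c assume "?m < c"
  then obtain r where r: "r \<in> {0..T}" "x r < c"
    using running_inf_approx[OF x T, of "c - ?m"] by auto
  define g where "g N = h N * real (nat \<lceil>r / h N\<rceil>)" for N
  have rh: "0 \<le> r / h N" for N using r h(1)[of N] by simp
  have ceil: "real (nat \<lceil>r / h N\<rceil>) = of_int \<lceil>r / h N\<rceil>" for N
    using rh[of N] by (simp add: of_nat_nat)
  have g: "r \<le> g N" "g N \<le> r + h N" for N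
    unfolding g_def ceil by (rule mult_ceiling[OF h(1)])+
  have "g \<longlonglongrightarrow> r"
  proof (rule tendsto_sandwich)
    show "eventually (\<lambda>N. r \<le> g N) sequentially" "eventually (\<lambda>N. g N \<le> r + h N) sequentially"
      using g by (auto intro: always_eventually)
    have "(\<lambda>N. r + h N) \<longlonglongrightarrow> r + 0" by (intro tendsto_intros h)
    then show "(\<lambda>N. r + h N) \<longlonglongrightarrow> r" by simp
  qed simp
  then have "(\<lambda>N. x (g N)) \<longlonglongrightarrow> x r"
    using r(1) by (intro cadlag_tendsto_from_right[OF x _ g(1)]) simp_all
  then have "eventually (\<lambda>N. x (g N) < c) sequentially"
    using r(2) by (rule order_tendstoD)
  then show "eventually (\<lambda>N. x (h N * J N) < c) sequentially"
  proof eventually_elim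
    case (elim N)
    have "r \<le> h N * K N" using K(1)[of N] r by simp
    then have "r / h N \<le> K N" using h(1)[of N] by (simp add: field_simps)
    then have "nat \<lceil>r / h N\<rceil> \<le> K N" by (simp add: ceiling_le_iff nat_le_iff)
    then show ?case using J(2)[of "nat \<lceil>r / h N\<rceil>" N] elim by (simp add: g_def)
  qed
qed

text \<open>
  For \<open>t > 0\<close> this is \<open>\<lceil>t / h\<rceil>\<close>, and at \<open>t = 0\<close> it is \<open>1\<close> instead of \<open>0\<close>, so that the grid
  point \<open>h * grid_index h t\<close> is always positive and at least \<open>t\<close>.
\<close>

definition grid_index :: "real \<Rightarrow> real \<Rightarrow> nat" where
  "grid_index h t = Suc (nat (\<lceil>t / h\<rceil> - 1))"

lemma grid_index_bounds:
  assumes h: "h > 0" and t: "0 \<le> t"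
  shows "t \<le> h * grid_index h t" "h * grid_index h t \<le> t + h"
proof -
  have "t \<le> h * real (grid_index h t) \<and> h * real (grid_index h t) \<le> t + h"
  proof (cases "t = 0")
    case False
    then have "0 < t / h" using h t by simp
    then have "1 \<le> \<lceil>t / h\<rceil>" by linarith
    then have "real (grid_index h t) = of_int \<lceil>t / h\<rceil>"
      by (simp add: grid_index_def of_nat_nat)
    then show ?thesis using mult_ceiling[OF h, of t] by simp
  qed (use h in \<open>simp add: grid_index_def\<close>)
  then show "t \<le> h * grid_index h t" "h * grid_index h t \<le> t + h" by auto
qed

lemma grid_index_le_iff:
  assumes h: "h > 0"
  shows "grid_index h t \<le> Suc k \<longleftrightarrow> t \<le> h * Suc k"
proof -
  have "grid_index h t \<le> Suc k \<longleftrightarrow> \<lceil>t / h\<rceil> \<le> int (Suc k)" by (auto simp: grid_index_def)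
  also have "\<dots> \<longleftrightarrow> t / h \<le> real (Suc k)" by (simp add: ceiling_le_iff)
  also have "\<dots> \<longleftrightarrow> t \<le> h * Suc k" using h by (simp add: field_simps)
  finally show ?thesis .
qed

section \<open>Cutting a walk at its first minimisers\<close>

definition first_min :: "real \<Rightarrow> (nat \<Rightarrow> real) \<Rightarrow> nat \<Rightarrow> nat" where
  "first_min \<sigma> S k = (LEAST j. j \<le> k \<and> (\<forall>r\<in>{..k}. S j - \<sigma> * j \<le> S r - \<sigma> * r))"

lemma first_min_exists: "\<exists>j. j \<le> k \<and> (\<forall>r\<in>{..k}. S j - \<sigma> * real j \<le> S r - \<sigma> * real r)"
proof -
  let ?g = "\<lambda>j. S j - \<sigma> * real j"
  have "Min (?g ` {..k}) \<in> ?g ` {..k}" by (intro Min_in) auto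
  then obtain j where j: "j \<le> k" "?g j = Min (?g ` {..k})" by (elim imageE) (metis atMost_iff)
  show ?thesis
    using j by (intro exI[of _ j]) auto
qed

lemma first_min_le: "first_min \<sigma> S k \<le> k"
  and first_min_minimal: "r \<le> k \<Longrightarrow> S (first_min \<sigma> S k) - \<sigma> * first_min \<sigma> S k \<le> S r - \<sigma> * r"
  using LeastI_ex[OF first_min_exists[of k S \<sigma>]] by (auto simp: first_min_def)

lemma first_min_first:
  assumes "r < first_min \<sigma> S k"
  shows "S (first_min \<sigma> S k) - \<sigma> * first_min \<sigma> S k < S r - \<sigma> * r"
proof (rule ccontr)
  assume "\<not> ?thesis"
  moreover have "r \<le> k" using assms first_min_le[of \<sigma> S k] by simp
  ultimately have "r \<le> k \<and> (\<forall>u\<in>{..k}. S r - \<sigma> * r \<le> S u - \<sigma> * u)"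
    using first_min_minimal[of _ k S \<sigma>] by fastforce
  then show False
    using assms not_less_Least unfolding first_min_def by blast
qed

lemma first_minI:
  assumes "j \<le> k" "\<And>r. r < j \<Longrightarrow> S j - \<sigma> * j < S r - \<sigma> * r"
    "\<And>r. j \<le> r \<Longrightarrow> r \<le> k \<Longrightarrow> S j - \<sigma> * j \<le> S r - \<sigma> * r"
  shows "first_min \<sigma> S k = j"
  unfolding first_min_def
proof (rule Least_equality)
  show "j \<le> k \<and> (\<forall>r\<in>{..k}. S j - \<sigma> * j \<le> S r - \<sigma> * r)"
  proof (intro conjI ballI)
    fix r assume "r \<in> {..k}"
    then show "S j - \<sigma> * j \<le> S r - \<sigma> * r"
      using assms(2)[of r] assms(3)[of r] by (cases "r < j") auto
  qed (rule assms(1))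
  fix u assume u: "u \<le> k \<and> (\<forall>r\<in>{..k}. S u - \<sigma> * u \<le> S r - \<sigma> * r)"
  show "j \<le> u"
  proof (rule ccontr)
    assume "\<not> j \<le> u"
    then have "S j - \<sigma> * j < S u - \<sigma> * u" by (intro assms(2)) simp
    moreover have "S u - \<sigma> * u \<le> S j - \<sigma> * j" using u assms(1) by simp
    ultimately show False by simp
  qed
qed

lemma first_min_mono:
  assumes "\<sigma> \<le> \<sigma>'"
  shows "first_min \<sigma> S k \<le> first_min \<sigma>' S k"
proof (rule ccontr)
  let ?a = "first_min \<sigma> S k" and ?b = "first_min \<sigma>' S k"
  assume "\<not> ?a \<le> ?b"
  then have less: "?b < ?a" by simp
  have "S ?a - \<sigma> * ?a < S ?b - \<sigma> * ?b" using first_min_first[OF less] .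
  moreover have "S ?b - \<sigma>' * ?b \<le> S ?a - \<sigma>' * ?a" using first_min_minimal[OF first_min_le] .
  ultimately have "(\<sigma>' - \<sigma>) * (real ?a - real ?b) < 0" by (simp add: algebra_simps)
  then show False using assms less by (simp add: mult_less_0_iff)
qed

text \<open>
  Including the two ends \<open>0\<close> and \<open>k\<close> of the walk as cuts number \<open>0\<close> and \<open>Suc n\<close> gives all \<open>n + 1\<close> pieces the
  same form.
\<close>

definition breakpoint :: "(nat \<Rightarrow> real) \<Rightarrow> nat \<Rightarrow> (nat \<Rightarrow> real) \<Rightarrow> nat \<Rightarrow> nat \<Rightarrow> nat" where
  "breakpoint \<sigma> n S k i = (if i = 0 then 0 else if i \<le> n then first_min (\<sigma> i) S k else k)"

text \<open>
  The condition on the \<open>i\<close>-th piece, where \<open>w r\<close> is the displacement after \<open>r\<close> of its \<open>l\<close> steps. The first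
  piece has no lower barrier and the last piece need not end at a minimum.
\<close>

definition good_piece :: "(nat \<Rightarrow> real) \<Rightarrow> nat \<Rightarrow> nat \<Rightarrow> nat \<Rightarrow> (nat \<Rightarrow> real) \<Rightarrow> bool" where
  "good_piece \<sigma> n i l w \<longleftrightarrow>
     (1 \<le> i \<longrightarrow> (\<forall>r\<in>{..l}. \<sigma> i * r \<le> w r)) \<and>
     (i < n \<longrightarrow> (\<forall>r\<in>{..<l}. w l - w r < \<sigma> (Suc i) * (real l - real r)))"

lemma breakpoint_mono:
  assumes \<sigma>: "mono_on {1..n} \<sigma>" and i: "i \<le> n"
  shows "breakpoint \<sigma> n S k i \<le> breakpoint \<sigma> n S k (Suc i)"
  using i mono_onD[OF \<sigma>, of i "Suc i"]
  by (auto simp: breakpoint_def first_min_le intro!: first_min_mono)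

lemma breakpoint_pieces_good:
  fixes S :: "nat \<Rightarrow> real" and k :: nat
  assumes \<sigma>: "mono_on {1..n} \<sigma>" and i: "i \<le> n"
  defines "b \<equiv> breakpoint \<sigma> n S k"
  shows "good_piece \<sigma> n i (b (Suc i) - b i) (\<lambda>r. S (b i + r) - S (b i))"
  unfolding good_piece_def
proof (intro conjI impI ballI)
  have le: "b i \<le> b (Suc i)" unfolding b_def by (rule breakpoint_mono[OF \<sigma> i])
  have lek: "b (Suc i) \<le> k" by (simp add: b_def breakpoint_def first_min_le)
  { fix r assume "1 \<le> i" "r \<in> {..b (Suc i) - b i}"
    then have "b i + r \<le> k" "b i = first_min (\<sigma> i) S k" using le lek i by (auto simp: b_def breakpoint_def)
    then show "\<sigma> i * r \<le> S (b i + r) - S (b i)"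
      using first_min_minimal[of "b i + r" k S "\<sigma> i"] by (simp add: algebra_simps) }
  { fix r assume "i < n" "r \<in> {..<b (Suc i) - b i}"
    then have "b i + r < b (Suc i)" "b (Suc i) = first_min (\<sigma> (Suc i)) S k"
      using le by (auto simp: b_def breakpoint_def)
    then show "S (b i + (b (Suc i) - b i)) - S (b i) - (S (b i + r) - S (b i))
        < \<sigma> (Suc i) * (real (b (Suc i) - b i) - real r)"
      using first_min_first[of "b i + r" "\<sigma> (Suc i)" S k] le by (simp add: of_nat_diff algebra_simps) }
qed

text \<open>
  The conditions on single pieces combine to the global minimality of the joints because the slopes
  increase: seen from the joint \<open>p i\<close>, every later piece lies above its own slope and hence above \<open>\<sigma> i\<close>
  (\<open>after\<close>), and every earlier piece descends to its end relative to its own slope and hence relative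
  to \<open>\<sigma> i\<close> (\<open>before\<close>). The strict inequality in \<open>before\<close> makes \<open>p i\<close> the first minimiser.
\<close>

lemma good_pieces_breakpoint:
  fixes l :: "nat \<Rightarrow> nat"
  assumes \<sigma>: "mono_on {1..n} \<sigma>"
  defines "p \<equiv> \<lambda>i. \<Sum>a<i. l a"
  assumes good: "\<And>i. i \<le> n \<Longrightarrow> good_piece \<sigma> n i (l i) (\<lambda>r. S (p i + r) - S (p i))"
    and i: "i \<le> Suc n"
  shows "breakpoint \<sigma> n S (p (Suc n)) i = p i"
proof -
  have p0 [simp]: "p 0 = 0" and pS: "p (Suc i) = p i + l i" for i by (auto simp: p_def)
  have pmono: "p i \<le> p j" if "i \<le> j" for i j
    using that by (auto simp: p_def intro!: sum_mono2)
  have \<sigma>le: "\<sigma> i \<le> \<sigma> j" if "1 \<le> i" "i \<le> j" "j \<le> n" for i j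
    using that by (intro mono_onD[OF \<sigma>]) auto
  have lo: "\<sigma> i * (real r - real (p i)) \<le> S r - S (p i)" if "1 \<le> i" "i \<le> n" "p i \<le> r" "r \<le> p (Suc i)" for i r
  proof -
    obtain d where d: "r = p i + d" using \<open>p i \<le> r\<close> le_Suc_ex by blast
    then have "d \<le> l i" using that by (simp add: pS)
    then show ?thesis using good[of i] that d by (simp add: good_piece_def)
  qed
  have up: "S (p (Suc i)) - S r < \<sigma> (Suc i) * (real (p (Suc i)) - real r)"
    if "i < n" "p i \<le> r" "r < p (Suc i)" for i r
  proof -
    obtain d where d: "r = p i + d" using \<open>p i \<le> r\<close> le_Suc_ex by blast
    then have "d < l i" using that by (simp add: pS)
    then show ?thesis using good[of i] that d by (simp add: good_piece_def pS)
  qed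
  have before: "S (p i) - S r < \<sigma> i * (real (p i) - real r)" if "i \<le> n" "r < p i" for i r
    using that
  proof (induction i)
    case (Suc i)
    show ?case
    proof (cases "p i \<le> r")
      case False
      then have r: "r < p i" by simp
      then have "1 \<le> i" by (cases i) auto
      have "S (p i) - S r < \<sigma> i * (real (p i) - real r)" using Suc r by simp
      also have "\<dots> \<le> \<sigma> (Suc i) * (real (p i) - real r)"
        using r \<open>1 \<le> i\<close> Suc.prems by (intro mult_right_mono \<sigma>le) auto
      finally have 1: "S (p i) - S r < \<sigma> (Suc i) * (real (p i) - real r)" .
      have "S (p (Suc i)) - S (p i) \<le> \<sigma> (Suc i) * (real (p (Suc i)) - real (p i))"
      proof (cases "l i = 0")
        case False
        then show ?thesis using up[of i "p i"] Suc.prems by (simp add: pS)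
      qed (simp add: pS)
      with 1 show ?thesis by (simp add: algebra_simps)
    qed (use up Suc.prems in simp)
  qed simp
  have after: "\<sigma> i * (real r - real (p i)) \<le> S r - S (p i)"
    if "1 \<le> i" "i \<le> m" "m \<le> n" "p i \<le> r" "r \<le> p (Suc m)" for i m r
    using that(2,3,4,5)
  proof (induction m arbitrary: r rule: dec_induct)
    case base
    then show ?case using lo \<open>1 \<le> i\<close> by simp
  next
    case (step m)
    show ?case
    proof (cases "r \<le> p (Suc m)")
      case False
      then have "\<sigma> i * (real r - real (p (Suc m))) \<le> \<sigma> (Suc m) * (real r - real (p (Suc m)))"
        using step \<open>1 \<le> i\<close> by (intro mult_right_mono \<sigma>le) auto
      also have "\<dots> \<le> S r - S (p (Suc m))"
        using False step by (intro lo) auto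
      finally have "\<sigma> i * (real r - real (p (Suc m))) \<le> S r - S (p (Suc m))" .
      moreover have "\<sigma> i * (real (p (Suc m)) - real (p i)) \<le> S (p (Suc m)) - S (p i)"
        using step pmono[of i "Suc m"] by simp
      ultimately show ?thesis by (simp add: algebra_simps)
    qed (use step in simp)
  qed
  show ?thesis
  proof (cases "i = 0 \<or> i = Suc n")
    case False
    then have "1 \<le> i" "i \<le> n" using i by auto
    have "first_min (\<sigma> i) S (p (Suc n)) = p i"
    proof (rule first_minI)
      show "p i \<le> p (Suc n)" by (rule pmono[OF i])
      show "S (p i) - \<sigma> i * p i < S r - \<sigma> i * r" if "r < p i" for r
        using before[OF \<open>i \<le> n\<close> that] by (simp add: algebra_simps)
      show "S (p i) - \<sigma> i * p i \<le> S r - \<sigma> i * r" if "p i \<le> r" "r \<le> p (Suc n)" for r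
        using after[OF \<open>1 \<le> i\<close> \<open>i \<le> n\<close> order_refl that] by (simp add: algebra_simps)
    qed
    then show ?thesis using \<open>1 \<le> i\<close> \<open>i \<le> n\<close> by (simp add: breakpoint_def)
  qed (auto simp: breakpoint_def)
qed

text \<open>
  Sending a length \<open>k\<close> to the lengths of the pieces of the first \<open>k\<close> steps is a bijection onto the
  tuples whose pieces are all good. The right-hand side no longer refers to the global minimisers, and
  its summands are products over disjoint stretches of the walk.
\<close>

lemma sum_over_lengths_eq_sum_over_good_lengths:
  fixes G :: "nat \<Rightarrow> nat \<Rightarrow> (nat \<Rightarrow> real) \<Rightarrow> ennreal" and S :: "nat \<Rightarrow> real"
  assumes \<sigma>: "mono_on {1..n} \<sigma>"
  defines "b \<equiv> breakpoint \<sigma> n S"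
  shows "(\<integral>\<^sup>+k. (\<Prod>i\<le>n. G i (b k (Suc i) - b k i) (\<lambda>r. S (b k i + r) - S (b k i))) \<partial>count_space UNIV) =
    (\<integral>\<^sup>+l. (\<Prod>i\<le>n. if good_piece \<sigma> n i (l i) (\<lambda>r. S ((\<Sum>a<i. l a) + r) - S (\<Sum>a<i. l a))
        then G i (l i) (\<lambda>r. S ((\<Sum>a<i. l a) + r) - S (\<Sum>a<i. l a)) else 0)
      \<partial>count_space ({..n} \<rightarrow>\<^sub>E UNIV))"
    (is "?lhs = integral\<^sup>N _ ?R")
proof -
  define p :: "(nat \<Rightarrow> nat) \<Rightarrow> nat \<Rightarrow> nat" where "p l i = (\<Sum>a<i. l a)" for l i
  define w where "w l i r = S (p l i + r) - S (p l i)" for l i r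
  define B where "B = {l \<in> {..n} \<rightarrow>\<^sub>E UNIV. \<forall>i\<le>n. good_piece \<sigma> n i (l i) (w l i)}"
  define \<psi> where "\<psi> k = (\<lambda>i\<in>{..n}. b k (Suc i) - b k i)" for k
  have bmono: "b k i \<le> b k (Suc i)" if "i \<le> n" for k i
    unfolding b_def by (rule breakpoint_mono[OF \<sigma> that])
  have p\<psi>: "p (\<psi> k) i = b k i" if "i \<le> Suc n" for k i
    using that
  proof (induction i)
    case 0
    then show ?case by (simp add: p_def b_def breakpoint_def)
  next
    case (Suc i)
    then show ?case using bmono[of i k] by (simp add: p_def \<psi>_def)
  qed
  have w\<psi>: "w (\<psi> k) i = (\<lambda>r. S (b k i + r) - S (b k i))" if "i \<le> n" for k i
    using that by (simp add: w_def fun_eq_iff p\<psi>)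
  have \<psi>i: "\<psi> k i = b k (Suc i) - b k i" if "i \<le> n" for k i
    using that by (simp add: \<psi>_def)
  have bS: "b k (Suc n) = k" for k by (simp add: b_def breakpoint_def)
  have bij: "bij_betw \<psi> UNIV B"
  proof (rule bij_betwI')
    show "\<psi> k = \<psi> k' \<longleftrightarrow> k = k'" for k k'
    proof
      assume "\<psi> k = \<psi> k'"
      then have "p (\<psi> k) (Suc n) = p (\<psi> k') (Suc n)" by simp
      then show "k = k'" by (simp only: p\<psi> bS order_refl)
    qed simp
    show "\<psi> k \<in> B" for k
    proof -
      have "good_piece \<sigma> n i (\<psi> k i) (w (\<psi> k) i)" if "i \<le> n" for i
        using breakpoint_pieces_good[OF \<sigma> that, of S k] by (simp only: \<psi>i w\<psi> that b_def)
      moreover have "\<psi> k \<in> {..n} \<rightarrow>\<^sub>E UNIV" by (simp add: \<psi>_def)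
      ultimately show ?thesis by (simp add: B_def)
    qed
    fix l assume l: "l \<in> B"
    show "\<exists>k\<in>UNIV. l = \<psi> k"
    proof (intro bexI ext)
      have "b (p l (Suc n)) i = p l i" if "i \<le> Suc n" for i
        using good_pieces_breakpoint[OF \<sigma>, of l S i] l that
        by (simp add: B_def p_def w_def[abs_def] b_def)
      then have "\<psi> (p l (Suc n)) i = l i" if "i \<le> n" for i
        using that by (simp add: \<psi>i p_def)
      moreover have "\<psi> (p l (Suc n)) i = l i" if "\<not> i \<le> n" for i
        using l that by (simp add: \<psi>_def B_def PiE_def extensional_def)
      ultimately show "l i = \<psi> (p l (Suc n)) i" for i by metis
    qed simp
  qed
  have "?lhs = (\<integral>\<^sup>+k. (\<Prod>i\<le>n. G i (\<psi> k i) (w (\<psi> k) i)) \<partial>count_space UNIV)"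
    by (intro nn_integral_cong prod.cong refl) (simp add: w\<psi> \<psi>i)
  also have "\<dots> = (\<integral>\<^sup>+l. (\<Prod>i\<le>n. G i (l i) (w l i)) \<partial>count_space B)"
    by (rule nn_integral_bij_count_space[OF bij])
  also have "\<dots> = (\<integral>\<^sup>+l. ?R l \<partial>count_space B)"
    by (intro nn_integral_cong prod.cong) (auto simp: B_def w_def[abs_def] p_def)
  also have "\<dots> = (\<integral>\<^sup>+l. ?R l \<partial>count_space ({..n} \<rightarrow>\<^sub>E UNIV))"
  proof (rule nn_integral_count_space_eq)
    fix l assume "l \<in> ({..n} \<rightarrow>\<^sub>E UNIV) - B"
    then obtain i where "i \<le> n" "\<not> good_piece \<sigma> n i (l i) (w l i)" by (auto simp: B_def)
    then show "?R l = 0" by (intro prod_zero) (auto simp: w_def[abs_def] p_def)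
  qed (auto simp: B_def)
  finally show ?thesis .
qed

section \<open>Random walks up to a geometric time\<close>

lemma nn_integral_prod_PiE:
  fixes f :: "'i \<Rightarrow> nat \<Rightarrow> ennreal"
  assumes "finite I"
  shows "(\<integral>\<^sup>+l. (\<Prod>i\<in>I. f i (l i)) \<partial>count_space (I \<rightarrow>\<^sub>E UNIV)) =
    (\<Prod>i\<in>I. \<integral>\<^sup>+x. f i x \<partial>count_space UNIV)"
proof -
  interpret product_sigma_finite "\<lambda>i::'i. count_space (UNIV :: nat set)"
    by (intro product_sigma_finite.intro sigma_finite_measure_count_space)
  have "count_space (I \<rightarrow>\<^sub>E (UNIV :: nat set)) = PiM I (\<lambda>i. count_space UNIV)"
    using count_space_PiM_finite[OF assms, of "\<lambda>_. UNIV :: nat set"] by simp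
  then show ?thesis
    using product_nn_integral_prod[OF assms, of f] by simp
qed

lemma measurable_good_piece:
  assumes "\<And>r. r \<le> l \<Longrightarrow> (\<lambda>x. w x r) \<in> borel_measurable N"
  shows "Measurable.pred N (\<lambda>x. good_piece \<sigma> n i l (w x))"
proof -
  have [measurable]: "Measurable.pred N (\<lambda>x. \<forall>r\<in>{..l}. \<sigma> i * r \<le> w x r)"
  proof (rule pred_intros_finite(3))
    show "Measurable.pred N (\<lambda>x. \<sigma> i * r \<le> w x r)" if "r \<in> {..l}" for r
    proof -
      have [measurable]: "(\<lambda>x. w x r) \<in> borel_measurable N" using that assms by simp
      show ?thesis by measurable
    qed
  qed simp
  have [measurable]: "Measurable.pred N (\<lambda>x. \<forall>r\<in>{..<l}. w x l - w x r < \<sigma> (Suc i) * (real l - real r))"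
  proof (rule pred_intros_finite(3))
    show "Measurable.pred N (\<lambda>x. w x l - w x r < \<sigma> (Suc i) * (real l - real r))" if "r \<in> {..<l}" for r
    proof -
      have [measurable]: "(\<lambda>x. w x r) \<in> borel_measurable N" "(\<lambda>x. w x l) \<in> borel_measurable N"
        using that assms by simp_all
      show ?thesis by measurable
    qed
  qed simp
  show ?thesis unfolding good_piece_def by measurable
qed

text \<open>
  The contribution of a single piece: the geometric weight of its length times the test function, or
  \<open>0\<close> if the piece is not admissible.
\<close>

definition piece_val ::
    "(nat \<Rightarrow> real) \<Rightarrow> nat \<Rightarrow> real \<Rightarrow> nat \<Rightarrow> (nat \<Rightarrow> real \<Rightarrow> ennreal) \<Rightarrow> nat \<Rightarrow> (nat \<Rightarrow> real) \<Rightarrow> ennreal" where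
  "piece_val \<sigma> n q i f l w = (if good_piece \<sigma> n i l w then ennreal q ^ l * f l (w l) else 0)"

lemma measurable_piece_val:
  assumes w: "\<And>r. r \<le> l \<Longrightarrow> (\<lambda>x. w x r) \<in> borel_measurable N"
    and [measurable]: "f l \<in> borel_measurable borel"
  shows "(\<lambda>x. piece_val \<sigma> n q i f l (w x)) \<in> borel_measurable N"
proof -
  have [measurable]: "Measurable.pred N (\<lambda>x. good_piece \<sigma> n i l (w x))"
    by (intro measurable_good_piece w)
  have [measurable]: "(\<lambda>x. w x l) \<in> borel_measurable N" by (simp add: w)
  show ?thesis unfolding piece_val_def by measurable
qed

lemma piece_val_cong:
  "(\<And>r. r \<le> l \<Longrightarrow> w r = w' r) \<Longrightarrow> piece_val \<sigma> n q i f l w = piece_val \<sigma> n q i f l w'"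
  by (auto simp: piece_val_def good_piece_def)

definition corner_prod ::
    "(nat \<Rightarrow> real) \<Rightarrow> nat \<Rightarrow> (nat \<Rightarrow> nat \<Rightarrow> real \<Rightarrow> ennreal) \<Rightarrow> (nat \<Rightarrow> real) \<Rightarrow> nat \<Rightarrow> ennreal" where
  "corner_prod \<sigma> n f S k = (\<Prod>i\<le>n. let b = breakpoint \<sigma> n S k in
     f i (b (Suc i) - b i) (S (b (Suc i)) - S (b i)))"

lemma measurable_corner_prod:
  assumes [measurable]: "\<And>r. (\<lambda>x. S x r) \<in> borel_measurable N" "\<And>i l. f i l \<in> borel_measurable borel"
  shows "(\<lambda>x. corner_prod \<sigma> n f (S x) k) \<in> borel_measurable N"
proof -
  have [measurable]: "(\<lambda>x. first_min a (S x) k) \<in> measurable N (count_space UNIV)" for a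
    unfolding first_min_def by measurable
  have b: "(\<lambda>x. breakpoint \<sigma> n (S x) k i) \<in> measurable N (count_space UNIV)" for i
    unfolding breakpoint_def by measurable
  have "(\<lambda>x. f i (breakpoint \<sigma> n (S x) k (Suc i) - u)
      (S x (breakpoint \<sigma> n (S x) k (Suc i)) - S x u)) \<in> borel_measurable N" for i u
    by (rule measurable_compose_countable[OF _ b[of "Suc i"], of "\<lambda>v x. f i (v - u) (S x v - S x u)"])
      measurable
  then have "(\<lambda>x. f i (breakpoint \<sigma> n (S x) k (Suc i) - breakpoint \<sigma> n (S x) k i)
      (S x (breakpoint \<sigma> n (S x) k (Suc i)) - S x (breakpoint \<sigma> n (S x) k i))) \<in> borel_measurable N" for i
    by (rule measurable_compose_countable[OF _ b[of i], of "\<lambda>u x. f i (breakpoint \<sigma> n (S x) k (Suc i) - u)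
      (S x (breakpoint \<sigma> n (S x) k (Suc i)) - S x u)"])
  then show ?thesis
    unfolding corner_prod_def Let_def by (intro borel_measurable_prod_ennreal) simp
qed

text \<open>
  A walk with independent steps of law \<open>D\<close>. Independence is stated for the steps after an arbitrary
  time \<open>a\<close>, so that later stretches of the walk can be compared with initial ones without reindexing.
\<close>

locale random_walk = prob_space +
  fixes S :: "nat \<Rightarrow> 'a \<Rightarrow> real" and D :: "real measure"
  assumes S_measurable [measurable]: "S k \<in> borel_measurable M"
    and S_0: "\<omega> \<in> space M \<Longrightarrow> S 0 \<omega> = 0"
    and increments_indep: "indep_vars (\<lambda>_. borel) (\<lambda>i \<omega>. S (Suc (a + i)) \<omega> - S (a + i) \<omega>) {..<k}"
    and increments_distr: "distr M borel (\<lambda>\<omega>. S (Suc i) \<omega> - S i \<omega>) = D"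
begin

text \<open>
  Blocks of \<open>Suc l\<close> steps serve pieces of \<open>l\<close> steps, so that the product measure has a nonempty index set
  even for \<open>l = 0\<close>.
\<close>

lemma block_distr:
  "distr M (PiM {..<Suc l} (\<lambda>_. borel)) (\<lambda>\<omega>. \<lambda>u\<in>{..<Suc l}. S (Suc (a + u)) \<omega> - S (a + u) \<omega>) =
    PiM {..<Suc l} (\<lambda>_. D)"
proof -
  have "distr M (PiM {..<Suc l} (\<lambda>_. borel)) (\<lambda>\<omega>. \<lambda>u\<in>{..<Suc l}. S (Suc (a + u)) \<omega> - S (a + u) \<omega>) =
    PiM {..<Suc l} (\<lambda>u. distr M borel (\<lambda>\<omega>. S (Suc (a + u)) \<omega> - S (a + u) \<omega>))"
    by (rule iffD1[OF indep_vars_iff_distr_eq_PiM increments_indep]) (simp_all add: lessThan_empty_iff)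
  then show ?thesis by (simp only: increments_distr)
qed

text \<open>
  The law of a piece depends on its length but not on its starting point, since both blocks of steps
  have the same product law.
\<close>

lemma nn_integral_piece_shift:
  assumes [measurable]: "f l \<in> borel_measurable borel"
  shows "(\<integral>\<^sup>+\<omega>. piece_val \<sigma> n q i f l (\<lambda>r. S (a + r) \<omega> - S a \<omega>) \<partial>M) =
    (\<integral>\<^sup>+\<omega>. piece_val \<sigma> n q i f l (\<lambda>r. S r \<omega>) \<partial>M)"
proof -
  let ?w = "\<lambda>y r. \<Sum>u<r. (y :: nat \<Rightarrow> real) u"
  have m: "(\<lambda>y. piece_val \<sigma> n q i f l (?w y)) \<in> borel_measurable (PiM {..<Suc l} (\<lambda>_. borel))"
    by (intro measurable_piece_val assms borel_measurable_sum measurable_component_singleton) auto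
  have *: "(\<integral>\<^sup>+\<omega>. piece_val \<sigma> n q i f l (\<lambda>r. S (a + r) \<omega> - S a \<omega>) \<partial>M) =
    (\<integral>\<^sup>+y. piece_val \<sigma> n q i f l (?w y) \<partial>PiM {..<Suc l} (\<lambda>_. D))" for a
  proof -
    have "(\<integral>\<^sup>+y. piece_val \<sigma> n q i f l (?w y) \<partial>PiM {..<Suc l} (\<lambda>_. D)) =
      (\<integral>\<^sup>+\<omega>. piece_val \<sigma> n q i f l (?w (\<lambda>u\<in>{..<Suc l}. S (Suc (a + u)) \<omega> - S (a + u) \<omega>)) \<partial>M)"
      unfolding block_distr[of l a, symmetric] by (subst nn_integral_distr) (simp_all add: m)
    also have "\<dots> = (\<integral>\<^sup>+\<omega>. piece_val \<sigma> n q i f l (\<lambda>r. S (a + r) \<omega> - S a \<omega>) \<partial>M)"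
    proof (intro nn_integral_cong piece_val_cong)
      fix \<omega> r assume "r \<le> l"
      then have "(\<Sum>u<r. (\<lambda>u\<in>{..<Suc l}. S (Suc (a + u)) \<omega> - S (a + u) \<omega>) u) =
        (\<Sum>u<r. S (a + Suc u) \<omega> - S (a + u) \<omega>)"
        by (intro sum.cong) auto
      also have "\<dots> = S (a + r) \<omega> - S a \<omega>"
        using sum_lessThan_telescope[of "\<lambda>u. S (a + u) \<omega>" r] by simp
      finally show "(\<Sum>u<r. (\<lambda>u\<in>{..<Suc l}. S (Suc (a + u)) \<omega> - S (a + u) \<omega>) u) = S (a + r) \<omega> - S a \<omega>" .
    qed
    finally show ?thesis by simp
  qed
  have "(\<integral>\<^sup>+\<omega>. piece_val \<sigma> n q i f l (\<lambda>r. S r \<omega>) \<partial>M) =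
    (\<integral>\<^sup>+\<omega>. piece_val \<sigma> n q i f l (\<lambda>r. S (0 + r) \<omega> - S 0 \<omega>) \<partial>M)"
    by (intro nn_integral_cong piece_val_cong) (simp add: S_0)
  with *[of a] *[of 0] show ?thesis by simp
qed

text \<open>
  The pieces depend on disjoint blocks of steps.
\<close>

lemma nn_integral_prod_pieces:
  assumes [measurable]: "\<And>i l. f i l \<in> borel_measurable borel"
  shows "(\<integral>\<^sup>+\<omega>. (\<Prod>i\<le>n. piece_val \<sigma> n q i (f i) (l i)
        (\<lambda>r. S ((\<Sum>a<i. l a) + r) \<omega> - S (\<Sum>a<i. l a) \<omega>)) \<partial>M) =
    (\<Prod>i\<le>n. \<integral>\<^sup>+\<omega>. piece_val \<sigma> n q i (f i) (l i) (\<lambda>r. S r \<omega>) \<partial>M)"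
proof -
  define p where "p i = (\<Sum>a<i. l a)" for i
  have pS: "p (Suc i) = p i + l i" for i by (simp add: p_def)
  have pmono: "p i \<le> p j" if "i \<le> j" for i j
    using that by (auto simp: p_def intro!: sum_mono2)
  let ?X = "\<lambda>u \<omega>. S (Suc u) \<omega> - S u \<omega>"
  let ?K = "\<lambda>i. {p i..<p (Suc i)}"
  let ?w = "\<lambda>i y r. \<Sum>u<r. (y :: nat \<Rightarrow> real) (p i + u)"
  let ?V = "\<lambda>i \<omega>. piece_val \<sigma> n q i (f i) (l i) (\<lambda>r. S (p i + r) \<omega> - S (p i) \<omega>)"
  have "indep_vars (\<lambda>_. borel) ?X {..<p (Suc n)}"
    using increments_indep[of 0 "p (Suc n)"] by simp
  then have "indep_vars (\<lambda>i. PiM (?K i) (\<lambda>_. borel)) (\<lambda>i \<omega>. \<lambda>u\<in>?K i. ?X u \<omega>) {..n}"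
  proof (rule indep_vars_restrict)
    show "?K i \<subseteq> {..<p (Suc n)}" if "i \<in> {..n}" for i
      using that pmono[of "Suc i" "Suc n"] by auto
    have "?K i \<inter> ?K j = {}" if "i < j" for i j
      using that pmono[of "Suc i" j] by auto
    then show "disjoint_family_on ?K {..n}"
      unfolding disjoint_family_on_def by (metis inf_commute linorder_neqE_nat)
  qed
  then have "indep_vars (\<lambda>_. borel)
    (\<lambda>i \<omega>. piece_val \<sigma> n q i (f i) (l i) (?w i (\<lambda>u\<in>?K i. ?X u \<omega>))) {..n}"
  proof (rule indep_vars_compose2[where Y = "\<lambda>i y. piece_val \<sigma> n q i (f i) (l i) (?w i y)"])
    show "(\<lambda>y. piece_val \<sigma> n q i (f i) (l i) (?w i y)) \<in> borel_measurable (PiM (?K i) (\<lambda>_. borel))" for i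
      by (intro measurable_piece_val assms borel_measurable_sum measurable_component_singleton)
        (auto simp: pS)
  qed
  also have "(\<lambda>i \<omega>. piece_val \<sigma> n q i (f i) (l i) (?w i (\<lambda>u\<in>?K i. ?X u \<omega>))) = ?V"
  proof (intro ext piece_val_cong)
    fix i \<omega> r assume "r \<le> l i"
    then have "?w i (\<lambda>u\<in>?K i. ?X u \<omega>) r = (\<Sum>u<r. S (p i + Suc u) \<omega> - S (p i + u) \<omega>)"
      by (intro sum.cong) (auto simp: pS)
    also have "\<dots> = S (p i + r) \<omega> - S (p i) \<omega>"
      using sum_lessThan_telescope[of "\<lambda>u. S (p i + u) \<omega>" r] by simp
    finally show "?w i (\<lambda>u\<in>?K i. ?X u \<omega>) r = S (p i + r) \<omega> - S (p i) \<omega>" .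
  qed
  finally have "(\<integral>\<^sup>+\<omega>. (\<Prod>i\<le>n. ?V i \<omega>) \<partial>M) = (\<Prod>i\<le>n. \<integral>\<^sup>+\<omega>. ?V i \<omega> \<partial>M)"
    by (intro indep_vars_nn_integral) auto
  also have "\<dots> = (\<Prod>i\<le>n. \<integral>\<^sup>+\<omega>. piece_val \<sigma> n q i (f i) (l i) (\<lambda>r. S r \<omega>) \<partial>M)"
    by (intro prod.cong nn_integral_piece_shift assms refl)
  finally show ?thesis by (simp add: p_def)
qed

text \<open>
  Summing over all tuples of lengths, the expectation of each summand is a product by independence of
  disjoint stretches, and the sum of the products is the product of the sums.
\<close>

lemma killed_walk_factorises:
  assumes \<sigma>: "mono_on {1..n} \<sigma>" and f [measurable]: "\<And>i l. f i l \<in> borel_measurable borel"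
  shows "(\<integral>\<^sup>+\<omega>. (\<integral>\<^sup>+k. ennreal q ^ k * corner_prod \<sigma> n f (\<lambda>r. S r \<omega>) k \<partial>count_space UNIV) \<partial>M) =
    (\<Prod>i\<le>n. \<integral>\<^sup>+l. (\<integral>\<^sup>+\<omega>. piece_val \<sigma> n q i (f i) l (\<lambda>r. S r \<omega>) \<partial>M) \<partial>count_space UNIV)"
proof -
  have "ennreal q ^ k * corner_prod \<sigma> n f (\<lambda>r. S r \<omega>) k =
    (\<Prod>i\<le>n. let b = breakpoint \<sigma> n (\<lambda>r. S r \<omega>) k in
       ennreal q ^ (b (Suc i) - b i) * f i (b (Suc i) - b i) (S (b i + (b (Suc i) - b i)) \<omega> - S (b i) \<omega>))"
    for k \<omega>
  proof -
    let ?b = "breakpoint \<sigma> n (\<lambda>r. S r \<omega>) k"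
    have mono: "?b i \<le> ?b (Suc i)" if "i \<le> n" for i
      by (rule breakpoint_mono[OF \<sigma> that])
    have "(\<Sum>i<m. ?b (Suc i) - ?b i) = ?b m" if "m \<le> Suc n" for m
      using that
    proof (induction m)
      case (Suc m)
      then show ?case using mono[of m] by simp
    qed (simp add: breakpoint_def)
    from this[of "Suc n"] have "(\<Sum>i\<le>n. ?b (Suc i) - ?b i) = k"
      by (simp add: breakpoint_def lessThan_Suc_atMost)
    then have "ennreal q ^ k = (\<Prod>i\<le>n. ennreal q ^ (?b (Suc i) - ?b i))"
      by (simp only: power_sum[symmetric])
    then show ?thesis
      using mono by (simp add: corner_prod_def prod.distrib Let_def)
  qed
  then have "(\<integral>\<^sup>+\<omega>. (\<integral>\<^sup>+k. ennreal q ^ k * corner_prod \<sigma> n f (\<lambda>r. S r \<omega>) k \<partial>count_space UNIV) \<partial>M) =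
    (\<integral>\<^sup>+\<omega>. (\<integral>\<^sup>+l. (\<Prod>i\<le>n. piece_val \<sigma> n q i (f i) (l i)
        (\<lambda>r. S ((\<Sum>a<i. l a) + r) \<omega> - S (\<Sum>a<i. l a) \<omega>))
      \<partial>count_space ({..n} \<rightarrow>\<^sub>E UNIV)) \<partial>M)"
    using sum_over_lengths_eq_sum_over_good_lengths[OF \<sigma>, where G = "\<lambda>i l w. ennreal q ^ l * f i l (w l)"
        and S = "\<lambda>r. S r _"]
    by (simp add: Let_def piece_val_def)
  also have "\<dots> = (\<integral>\<^sup>+l. (\<integral>\<^sup>+\<omega>. (\<Prod>i\<le>n. piece_val \<sigma> n q i (f i) (l i)
        (\<lambda>r. S ((\<Sum>a<i. l a) + r) \<omega> - S (\<Sum>a<i. l a) \<omega>)) \<partial>M)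
      \<partial>count_space ({..n} \<rightarrow>\<^sub>E UNIV))"
    by (intro nn_integral_count_space_nn_integral countable_PiE borel_measurable_prod_ennreal measurable_piece_val)
      auto
  also have "\<dots> = (\<Prod>i\<le>n. \<integral>\<^sup>+l. (\<integral>\<^sup>+\<omega>. piece_val \<sigma> n q i (f i) l (\<lambda>r. S r \<omega>) \<partial>M) \<partial>count_space UNIV)"
    using nn_integral_prod_PiE[of "{..n}" "\<lambda>i l. \<integral>\<^sup>+\<omega>. piece_val \<sigma> n q i (f i) l (\<lambda>r. S r \<omega>) \<partial>M"]
    by (simp add: nn_integral_prod_pieces)
  finally show ?thesis .
qed

text \<open>
  The expectation of a path functional at an independent geometric time on \<open>{0, 1, \<dots>}\<close>. The geometric
  time enters only through its weights.
\<close>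

definition geom_mean :: "real \<Rightarrow> ((nat \<Rightarrow> real) \<Rightarrow> nat \<Rightarrow> ennreal) \<Rightarrow> ennreal" where
  "geom_mean q \<Phi> = (\<integral>\<^sup>+\<omega>. (\<integral>\<^sup>+k. ennreal (1 - q) * ennreal q ^ k * \<Phi> (\<lambda>r. S r \<omega>) k \<partial>count_space UNIV) \<partial>M)"

lemma geom_mean_1:
  assumes "0 \<le> q" "q < 1"
  shows "geom_mean q (\<lambda>_ _. 1) = 1"
proof -
  have "(\<integral>\<^sup>+k. ennreal (1 - q) * ennreal q ^ k * 1 \<partial>count_space UNIV) =
    (\<Sum>k. ennreal ((1 - q) * q ^ k))"
    using assms by (simp add: nn_integral_count_space_nat ennreal_power ennreal_mult)
  also have "\<dots> = ennreal 1"
  proof (rule suminf_ennreal_eq)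
    show "(\<lambda>k. (1 - q) * q ^ k) sums 1"
      using sums_mult[OF geometric_sums[of q], of "1 - q"] assms by simp
  qed (use assms in auto)
  finally show ?thesis by (simp add: geom_mean_def emeasure_space_1)
qed

text \<open>
  The factorisation \<open>(1 - q) \<Prod> c i (f i)\<close> of \<open>killed_walk_factorises\<close> has unnormalised factors. Putting
  \<open>f j = 1\<close> for all \<open>j\<close> gives \<open>(1 - q) \<Prod> c j 1 = 1\<close>, and putting \<open>f j = 1\<close> for \<open>j \<noteq> i\<close> gives the marginal of
  \<open>i\<close> as \<open>c i (f i) / c i 1\<close>; so the product is that of the marginals. Division is avoided by
  multiplying with the complementary product, see \<open>inv\<close>.
\<close>

theorem geom_mean_corner_prod:
  assumes \<sigma>: "mono_on {1..n} \<sigma>" and f [measurable]: "\<And>i l. f i l \<in> borel_measurable borel"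
    and q: "0 \<le> q" "q < 1"
  shows "geom_mean q (corner_prod \<sigma> n f) =
    (\<Prod>i\<le>n. geom_mean q (corner_prod \<sigma> n (\<lambda>j. if j = i then f i else (\<lambda>_ _. 1))))"
proof -
  define c where "c i g = (\<integral>\<^sup>+l. (\<integral>\<^sup>+\<omega>. piece_val \<sigma> n q i g l (\<lambda>r. S r \<omega>) \<partial>M) \<partial>count_space UNIV)"
    for i and g :: "nat \<Rightarrow> real \<Rightarrow> ennreal"
  let ?p = "ennreal (1 - q)" and ?one = "\<lambda>_ _. 1 :: ennreal"
  have E: "geom_mean q (corner_prod \<sigma> n g) = ?p * (\<Prod>i\<le>n. c i (g i))"
    if g [measurable]: "\<And>i l. g i l \<in> borel_measurable borel" for g
  proof -
    have [measurable]: "(\<lambda>\<omega>. corner_prod \<sigma> n g (\<lambda>r. S r \<omega>) k) \<in> borel_measurable M" for k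
      by (intro measurable_corner_prod) auto
    have "geom_mean q (corner_prod \<sigma> n g) =
      (\<integral>\<^sup>+\<omega>. ?p * (\<integral>\<^sup>+k. ennreal q ^ k * corner_prod \<sigma> n g (\<lambda>r. S r \<omega>) k \<partial>count_space UNIV) \<partial>M)"
      unfolding geom_mean_def mult.assoc
      by (intro nn_integral_cong nn_integral_cmult) auto
    also have "\<dots> = ?p * (\<integral>\<^sup>+\<omega>. (\<integral>\<^sup>+k. ennreal q ^ k * corner_prod \<sigma> n g (\<lambda>r. S r \<omega>) k \<partial>count_space UNIV) \<partial>M)"
      unfolding nn_integral_count_space_nat by (intro nn_integral_cmult) measurable
    finally have "geom_mean q (corner_prod \<sigma> n g) =
      ?p * (\<integral>\<^sup>+\<omega>. (\<integral>\<^sup>+k. ennreal q ^ k * corner_prod \<sigma> n g (\<lambda>r. S r \<omega>) k \<partial>count_space UNIV) \<partial>M)" .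
    then show ?thesis
      by (simp add: killed_walk_factorises[OF \<sigma> g] c_def)
  qed
  have one: "?p * (\<Prod>i\<le>n. c i ?one) = 1"
    using E[of "\<lambda>_. ?one"] geom_mean_1[OF q] by (simp add: corner_prod_def[abs_def])
  have inv: "c i ?one * (?p * (\<Prod>j\<in>{..n} - {i}. c j ?one)) = 1" if "i \<le> n" for i
    using one that by (subst (asm) prod.remove[of _ i]) (auto simp: ac_simps)
  have "(\<Prod>i\<le>n. geom_mean q (corner_prod \<sigma> n (\<lambda>j. if j = i then f i else ?one))) =
    (\<Prod>i\<le>n. c i (f i) * (?p * (\<Prod>j\<in>{..n} - {i}. c j ?one)))"
  proof (rule prod.cong[OF refl])
    fix i assume i: "i \<in> {..n}"
    have "geom_mean q (corner_prod \<sigma> n (\<lambda>j. if j = i then f i else ?one)) =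
      ?p * (\<Prod>j\<le>n. c j (if j = i then f i else ?one))"
      by (rule E) auto
    also have "(\<Prod>j\<le>n. c j (if j = i then f i else ?one)) =
      c i (f i) * (\<Prod>j\<in>{..n} - {i}. c j ?one)"
      using i by (subst prod.remove[of _ i]) auto
    finally show "geom_mean q (corner_prod \<sigma> n (\<lambda>j. if j = i then f i else ?one)) =
      c i (f i) * (?p * (\<Prod>j\<in>{..n} - {i}. c j ?one))" by (simp add: ac_simps)
  qed
  also have "\<dots> = (\<Prod>i\<le>n. c i (f i)) * (\<Prod>i\<le>n. ?p * (\<Prod>j\<in>{..n} - {i}. c j ?one))"
    by (simp add: prod.distrib)
  also have "(\<Prod>i\<le>n. ?p * (\<Prod>j\<in>{..n} - {i}. c j ?one)) =
    (?p * (\<Prod>i\<le>n. c i ?one)) * (\<Prod>i\<le>n. ?p * (\<Prod>j\<in>{..n} - {i}. c j ?one))"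
    using one by simp
  also have "\<dots> = ?p * (\<Prod>i\<le>n. c i ?one * (?p * (\<Prod>j\<in>{..n} - {i}. c j ?one)))"
    by (subst prod.distrib) (simp only: mult.assoc)
  also have "\<dots> = ?p" by (simp add: inv)
  finally show ?thesis by (simp add: E[OF f] mult.commute)
qed

end

section \<open>Independence through continuous test functions\<close>

text \<open>
  The indicator of a closed set \<open>A\<close> is the limit of the continuous functions \<open>max 0 (1 - k dist(x, A))\<close>, and
  closed sets form a generator of the Borel sets that is stable under intersection.
\<close>

lemma (in prob_space) indep_vars_if_continuous_test_functions:
  fixes Z :: "'i \<Rightarrow> 'a \<Rightarrow> 'b::metric_space"
  assumes I: "finite I" "I \<noteq> {}" and Z [measurable]: "\<And>i. i \<in> I \<Longrightarrow> random_variable borel (Z i)"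
    and test: "\<And>F :: 'i \<Rightarrow> 'b \<Rightarrow> real. (\<And>i. continuous_on UNIV (F i)) \<Longrightarrow> (\<And>i x. F i x \<in> {0..1}) \<Longrightarrow>
      expectation (\<lambda>\<omega>. \<Prod>i\<in>I. F i (Z i \<omega>)) = (\<Prod>i\<in>I. expectation (\<lambda>\<omega>. F i (Z i \<omega>)))"
  shows "indep_vars (\<lambda>_. borel) Z I"
proof -
  have sets: "sets (borel :: 'b measure) = sigma_sets (space borel) {A. closed A}"
    by (simp add: borel_eq_closed sets_measure_of)
  have stable: "Int_stable {A :: 'b set. closed A}" by (auto simp: Int_stable_def)
  have "indep_vars (\<lambda>_. borel) Z I \<longleftrightarrow> (\<forall>A\<in>I \<rightarrow> {A. closed A}.
    prob (\<Inter>j\<in>I. Z j -` A j \<inter> space M) = (\<Prod>j\<in>I. prob (Z j -` A j \<inter> space M)))"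
    by (rule indep_vars_finite) (use I Z sets stable in auto)
  moreover have "\<forall>A\<in>I \<rightarrow> {A. closed A}.
    prob (\<Inter>j\<in>I. Z j -` A j \<inter> space M) = (\<Prod>j\<in>I. prob (Z j -` A j \<inter> space M))"
  proof
    fix A assume A: "A \<in> I \<rightarrow> {A :: 'b set. closed A}"
    \<comment> \<open>The case distinction is due to the convention \<open>infdist x {} = 0\<close>.\<close>
    define F where "F k i x = (if A i = {} then 0 else max 0 (1 - real k * infdist x (A i)))" for k i x
    have cont: "continuous_on UNIV (F k i)" for k i
      unfolding F_def by (cases "A i = {}") (auto intro!: continuous_intros)
    have range: "F k i x \<in> {0..1}" for k i x
      by (auto simp: F_def infdist_nonneg)
    have [measurable]: "F k i \<in> borel_measurable borel" for k i
      by (intro borel_measurable_continuous_onI cont)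
    have lim: "(\<lambda>k. F k i x) \<longlonglongrightarrow> indicator (A i) x" if "i \<in> I" for i x
    proof (cases "x \<in> A i")
      case True
      then have "F k i x = 1" for k by (auto simp: F_def)
      then show ?thesis using True by simp
    next
      case False
      show ?thesis
      proof (cases "A i = {}")
        case ne: False
        have "infdist x (A i) \<noteq> 0"
          using in_closed_iff_infdist_zero[of "A i" x] A ne False \<open>i \<in> I\<close> by auto
        then have pos: "infdist x (A i) > 0" using infdist_nonneg[of x "A i"] by simp
        obtain K :: nat where K: "1 / infdist x (A i) < K" using reals_Archimedean2 by blast
        have "F k i x = 0" if "K \<le> k" for k
        proof -
          have "1 / infdist x (A i) \<le> k" using K that by linarith
          then show ?thesis using pos by (simp add: F_def field_simps)
        qed
        then have "eventually (\<lambda>k. F k i x = 0) sequentially"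
          by (auto simp: eventually_sequentially)
        then show ?thesis using False by (simp add: tendsto_eventually)
      qed (simp add: F_def)
    qed
    have "(\<lambda>k. expectation (\<lambda>\<omega>. \<Prod>i\<in>I. F k i (Z i \<omega>))) \<longlonglongrightarrow>
      expectation (\<lambda>\<omega>. \<Prod>i\<in>I. indicator (A i) (Z i \<omega>))"
    proof (rule integral_dominated_convergence[where w = "\<lambda>_. 1"])
      show "AE \<omega> in M. (\<lambda>k. \<Prod>i\<in>I. F k i (Z i \<omega>)) \<longlonglongrightarrow> (\<Prod>i\<in>I. indicator (A i) (Z i \<omega>))"
        by (intro AE_I2 tendsto_prod lim)
      show "AE \<omega> in M. norm (\<Prod>i\<in>I. F k i (Z i \<omega>)) \<le> 1" for k
        using range by (intro AE_I2) (auto simp: abs_prod intro!: prod_le_1)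
      have "A i \<in> sets borel" if "i \<in> I" for i using A that by (auto intro: borel_closed)
      then show "(\<lambda>\<omega>. \<Prod>i\<in>I. indicator (A i) (Z i \<omega>) :: real) \<in> borel_measurable M"
        by (intro borel_measurable_prod) simp
      show "(\<lambda>\<omega>. \<Prod>i\<in>I. F k i (Z i \<omega>)) \<in> borel_measurable M" for k
        by (intro borel_measurable_prod) simp
    qed simp
    moreover have "(\<lambda>k. \<Prod>i\<in>I. expectation (\<lambda>\<omega>. F k i (Z i \<omega>))) \<longlonglongrightarrow>
      (\<Prod>i\<in>I. expectation (\<lambda>\<omega>. indicator (A i) (Z i \<omega>)))"
    proof (intro tendsto_prod)
      fix i assume i: "i \<in> I"
      show "(\<lambda>k. expectation (\<lambda>\<omega>. F k i (Z i \<omega>))) \<longlonglongrightarrow> expectation (\<lambda>\<omega>. indicator (A i) (Z i \<omega>))"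
      proof (rule integral_dominated_convergence[where w = "\<lambda>_. 1"])
        show "AE \<omega> in M. (\<lambda>k. F k i (Z i \<omega>)) \<longlonglongrightarrow> indicator (A i) (Z i \<omega>)"
          by (intro AE_I2 lim i)
        show "AE \<omega> in M. norm (F k i (Z i \<omega>)) \<le> 1" for k
          using range by (intro AE_I2) auto
        have "A i \<in> sets borel" using A i by (auto intro: borel_closed)
        with i show "(\<lambda>\<omega>. indicator (A i) (Z i \<omega>) :: real) \<in> borel_measurable M" by simp
        show "(\<lambda>\<omega>. F k i (Z i \<omega>)) \<in> borel_measurable M" for k using i by simp
      qed simp
    qed
    ultimately have *: "expectation (\<lambda>\<omega>. \<Prod>i\<in>I. indicator (A i) (Z i \<omega>) :: real) =
      (\<Prod>i\<in>I. expectation (\<lambda>\<omega>. indicator (A i) (Z i \<omega>)))"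
      by (intro LIMSEQ_unique) (simp_all add: test[OF cont range])
    have sub: "Z i -` A i \<inter> space M \<in> events" if "i \<in> I" for i
      using A that by (intro measurable_sets[OF Z]) (auto intro: borel_closed)
    have "expectation (\<lambda>\<omega>. \<Prod>i\<in>I. indicator (A i) (Z i \<omega>) :: real) =
      expectation (indicator (\<Inter>j\<in>I. Z j -` A j \<inter> space M))"
    proof (intro Bochner_Integration.integral_cong refl)
      fix \<omega> assume "\<omega> \<in> space M"
      show "(\<Prod>i\<in>I. indicator (A i) (Z i \<omega>)) = (indicator (\<Inter>j\<in>I. Z j -` A j \<inter> space M) \<omega> :: real)"
      proof (cases "\<forall>i\<in>I. Z i \<omega> \<in> A i")
        case False
        then show ?thesis using I by (auto simp: indicator_def)
      qed (use \<open>\<omega> \<in> space M\<close> in \<open>simp add: indicator_def\<close>)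
    qed
    also have "\<dots> = prob (\<Inter>j\<in>I. Z j -` A j \<inter> space M)"
      using I sub by (simp add: sets.finite_INT)
    finally have 1: "expectation (\<lambda>\<omega>. \<Prod>i\<in>I. indicator (A i) (Z i \<omega>)) =
      prob (\<Inter>j\<in>I. Z j -` A j \<inter> space M)" .
    have 2: "expectation (\<lambda>\<omega>. indicator (A i) (Z i \<omega>)) = prob (Z i -` A i \<inter> space M)" if "i \<in> I" for i
    proof -
      have "expectation (\<lambda>\<omega>. indicator (A i) (Z i \<omega>) :: real) = expectation (indicator (Z i -` A i \<inter> space M))"
        by (intro Bochner_Integration.integral_cong) (auto simp: indicator_def)
      then show ?thesis using sub[OF that] by simp
    qed
    show "prob (\<Inter>j\<in>I. Z j -` A j \<inter> space M) = (\<Prod>j\<in>I. prob (Z j -` A j \<inter> space M))"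
      using * by (simp add: 1 2)
  qed
  ultimately show ?thesis by simp
qed

section \<open>Levy processes at random times\<close>

lemma section_measurable:
  fixes G :: "real \<times> real \<Rightarrow> real"
  assumes "continuous_on UNIV G"
  shows "(\<lambda>d. ennreal (G (c, d))) \<in> borel_measurable borel"
proof -
  have "continuous_on UNIV (\<lambda>d. G (c, d))"
    by (rule continuous_on_compose2[OF assms]) (auto intro!: continuous_intros)
  then have "(\<lambda>d. G (c, d)) \<in> borel_measurable borel" by (rule borel_measurable_continuous_onI)
  then show ?thesis by simp
qed

lemma sigma_sets_vimage_comp_subset:
  assumes f: "f \<in> measurable N K" and Y: "Y \<in> measurable M N"
  shows "sigma_sets (space M) {(\<lambda>\<omega>. f (Y \<omega>)) -` A \<inter> space M | A. A \<in> sets K} \<subseteq>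
    sigma_sets (space M) {Y -` A \<inter> space M | A. A \<in> sets N}"
proof (rule sigma_sets_mono', rule subsetI)
  fix C assume "C \<in> {(\<lambda>\<omega>. f (Y \<omega>)) -` A \<inter> space M | A. A \<in> sets K}"
  then obtain A where A: "A \<in> sets K" "C = (\<lambda>\<omega>. f (Y \<omega>)) -` A \<inter> space M" by blast
  have "C = Y -` (f -` A \<inter> space N) \<inter> space M"
    using measurable_space[OF Y] A(2) by auto
  with measurable_sets[OF f A(1)] show "C \<in> {Y -` A \<inter> space M | A. A \<in> sets N}" by blast
qed

context levy_process
begin

text \<open>
  By right-continuity, the value at a random time is the limit of values at times from a countable
  grid.
\<close>

lemma measurable_at_random_time:
  assumes [measurable]: "U \<in> borel_measurable M" and U: "\<And>\<omega>. \<omega> \<in> space M \<Longrightarrow> 0 \<le> U \<omega>"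
  shows "(\<lambda>\<omega>. X (U \<omega>) \<omega>) \<in> borel_measurable M"
proof (rule borel_measurable_LIMSEQ_real)
  define h where "h N = inverse (real (Suc N))" for N
  have h: "h N > 0" for N by (simp add: h_def)
  have [measurable]: "(\<lambda>\<omega>. grid_index (h N) (U \<omega>)) \<in> measurable M (count_space UNIV)" for N
    unfolding grid_index_def by measurable
  show "(\<lambda>\<omega>. X (h N * grid_index (h N) (U \<omega>)) \<omega>) \<in> borel_measurable M" for N
  proof (rule measurable_compose_countable[where f = "\<lambda>k \<omega>. X (h N * real k) \<omega>" and g = "\<lambda>\<omega>. grid_index (h N) (U \<omega>)"])
    show "(\<lambda>\<omega>. X (h N * real k) \<omega>) \<in> borel_measurable M" for k
      using h[of N] by (intro random_variable_X) simp
  qed measurable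
  fix \<omega> assume \<omega>: "\<omega> \<in> space M"
  have "(\<lambda>N. h N * grid_index (h N) (U \<omega>)) \<longlonglongrightarrow> U \<omega>"
  proof (rule tendsto_sandwich)
    show "eventually (\<lambda>N. U \<omega> \<le> h N * grid_index (h N) (U \<omega>)) sequentially"
      "eventually (\<lambda>N. h N * grid_index (h N) (U \<omega>) \<le> U \<omega> + h N) sequentially"
      using grid_index_bounds[OF h U[OF \<omega>]] by (auto intro: always_eventually)
    have "(\<lambda>N. U \<omega> + h N) \<longlonglongrightarrow> U \<omega> + 0"
      unfolding h_def by (intro tendsto_intros LIMSEQ_inverse_real_of_nat)
    then show "(\<lambda>N. U \<omega> + h N) \<longlonglongrightarrow> U \<omega>" by simp
  qed simp
  then show "(\<lambda>N. X (h N * grid_index (h N) (U \<omega>)) \<omega>) \<longlonglongrightarrow> X (U \<omega>) \<omega>"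
    by (rule cadlag_tendsto_from_right[OF cadlag_paths[OF \<omega>] U[OF \<omega>] grid_index_bounds(1)[OF h U[OF \<omega>]]])
qed

lemma measurable_running_inf:
  assumes U_meas [measurable]: "U \<in> borel_measurable M" and U: "\<And>\<omega>. \<omega> \<in> space M \<Longrightarrow> 0 \<le> U \<omega>"
  shows "(\<lambda>\<omega>. running_inf (\<lambda>t. X t \<omega> - s * t) (U \<omega>)) \<in> borel_measurable M"
proof (rule borel_measurable_LIMSEQ_real)
  define h where "h N = inverse (real (Suc N))" for N
  have h: "h N > 0" for N by (simp add: h_def)
  have h0: "h \<longlonglongrightarrow> 0" unfolding h_def[abs_def] by (rule LIMSEQ_inverse_real_of_nat)
  have [measurable]: "(\<lambda>\<omega>. grid_index (h N) (U \<omega>)) \<in> measurable M (count_space UNIV)" for N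
    unfolding grid_index_def by measurable
  have X_grid [measurable]: "(\<lambda>\<omega>. X (h N * real k) \<omega>) \<in> borel_measurable M" for k N
    using h[of N] by (intro random_variable_X) simp
  \<comment> \<open>The drift is already part of the path, so the discrete slope is \<open>0\<close>.\<close>
  define J where "J N k \<omega> = first_min 0 (\<lambda>r. X (h N * real r) \<omega> - s * (h N * real r)) k" for N k \<omega>
  have [measurable]: "(\<lambda>\<omega>. J N k \<omega>) \<in> measurable M (count_space UNIV)" for N k
    unfolding J_def first_min_def by measurable
  have "(\<lambda>\<omega>. X (h N * real (J N k \<omega>)) \<omega> - s * (h N * real (J N k \<omega>))) \<in> borel_measurable M" for N k
    by (rule measurable_compose_countable[where f = "\<lambda>j \<omega>. X (h N * real j) \<omega> - s * (h N * real j)"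
          and g = "J N k"]) measurable
  then show "(\<lambda>\<omega>. X (h N * real (J N (grid_index (h N) (U \<omega>)) \<omega>)) \<omega> -
      s * (h N * real (J N (grid_index (h N) (U \<omega>)) \<omega>))) \<in> borel_measurable M" for N
    by (rule measurable_compose_countable[where g = "\<lambda>\<omega>. grid_index (h N) (U \<omega>)" and
       f = "\<lambda>k \<omega>. X (h N * real (J N k \<omega>)) \<omega> - s * (h N * real (J N k \<omega>))"]) measurable
  fix \<omega> assume \<omega>: "\<omega> \<in> space M"
  show "(\<lambda>N. X (h N * real (J N (grid_index (h N) (U \<omega>)) \<omega>)) \<omega> -
      s * (h N * real (J N (grid_index (h N) (U \<omega>)) \<omega>))) \<longlonglongrightarrow> running_inf (\<lambda>t. X t \<omega> - s * t) (U \<omega>)"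
  proof (rule grid_minimum_tendsto[OF cadlag_drift[OF cadlag_paths[OF \<omega>]] U[OF \<omega>] h h0 grid_index_bounds[OF h U[OF \<omega>]]])
    show "J N (grid_index (h N) (U \<omega>)) \<omega> \<le> grid_index (h N) (U \<omega>)" for N
      unfolding J_def by (rule first_min_le)
    show "X (h N * real (J N (grid_index (h N) (U \<omega>)) \<omega>)) \<omega> - s * (h N * real (J N (grid_index (h N) (U \<omega>)) \<omega>))
      \<le> X (h N * real r) \<omega> - s * (h N * real r)" if "r \<le> grid_index (h N) (U \<omega>)" for N r
      using first_min_minimal[OF that, of "\<lambda>r. X (h N * real r) \<omega> - s * (h N * real r)" 0]
      unfolding J_def by simp
  qed
qed

lemma measurable_inf_time:
  assumes [measurable]: "U \<in> borel_measurable M" and U: "\<And>\<omega>. \<omega> \<in> space M \<Longrightarrow> 0 \<le> U \<omega>"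
  shows "(\<lambda>\<omega>. inf_time (\<lambda>t. X t \<omega> - s * t) (U \<omega>)) \<in> borel_measurable M"
  unfolding borel_measurable_iff_le
proof
  fix a
  let ?y = "\<lambda>\<omega> t. X t \<omega> - s * t"
  have y: "cadlag (?y \<omega>)" if "\<omega> \<in> space M" for \<omega> by (intro cadlag_drift cadlag_paths that)
  show "{\<omega> \<in> space M. inf_time (?y \<omega>) (U \<omega>) \<le> a} \<in> events"
  proof (cases "0 \<le> a")
    case True
    have [measurable]: "(\<lambda>\<omega>. running_inf (?y \<omega>) (min a (U \<omega>))) \<in> borel_measurable M"
      "(\<lambda>\<omega>. running_inf (?y \<omega>) (U \<omega>)) \<in> borel_measurable M"
      using True U by (auto intro!: measurable_running_inf)
    have "{\<omega> \<in> space M. inf_time (?y \<omega>) (U \<omega>) \<le> a} =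
      {\<omega> \<in> space M. running_inf (?y \<omega>) (min a (U \<omega>)) = running_inf (?y \<omega>) (U \<omega>)}"
      using inf_time_le_iff[OF y True U] by blast
    also have "\<dots> \<in> events" by measurable
    finally show ?thesis .
  next
    case False
    have "{\<omega> \<in> space M. inf_time (?y \<omega>) (U \<omega>) \<le> a} = {}"
      using inf_time_bounds(1)[OF y U] False by fastforce
    then show ?thesis by (simp only: sets.empty_sets)
  qed
qed

lemma random_walk_grid:
  assumes h: "h > 0"
  shows "random_walk M (\<lambda>k \<omega>. X (h * real k) \<omega>) (distr M borel (\<lambda>\<omega>. X h \<omega> - X 0 \<omega>))"
proof
  show "X (h * real k) \<in> borel_measurable M" for k
    using h by (intro random_variable_X) simp
  show "X (h * real 0) \<omega> = 0" if "\<omega> \<in> space M" for \<omega>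
    using start_zero[OF that] by simp
  show "distr M borel (\<lambda>\<omega>. X (h * real (Suc i)) \<omega> - X (h * real i) \<omega>) = distr M borel (\<lambda>\<omega>. X h \<omega> - X 0 \<omega>)" for i
    using stationary_increments[of "h * real i" "h * real (Suc i)"] h by (simp add: algebra_simps)
  show "indep_vars (\<lambda>_. borel) (\<lambda>i \<omega>. X (h * real (Suc (a + i))) \<omega> - X (h * real (a + i)) \<omega>) {..<k}" for a k
    using independent_increments[of "\<lambda>i. h * real (a + i)" k] h
    by (simp add: strict_mono_on_def)
qed

end

locale levy_exponential_time = levy_process M X
  for M :: "'a measure" and X :: "real \<Rightarrow> 'a \<Rightarrow> real" +
  fixes T :: "'a \<Rightarrow> real" and \<theta> :: real
  assumes theta: "\<theta> > 0"
    and T_nonneg: "\<omega> \<in> space M \<Longrightarrow> T \<omega> \<ge> 0"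
    and T_exp: "distributed M lborel T (exponential_density \<theta>)"
    and T_indep: "indep_var_het borel T (Pi\<^sub>M {0..} (\<lambda>_. borel)) (\<lambda>\<omega>. \<lambda>t\<in>{0..}. X t \<omega>)"
begin

lemma T_measurable [measurable]: "T \<in> borel_measurable M"
  using T_indep by (simp add: indep_var_het_def)

text \<open>
  The time and the path take values in different types, so independence is passed to real functions of
  them before the product rule is applied.
\<close>

lemma nn_integral_indep:
  fixes f :: "real \<Rightarrow> ennreal" and g :: "(real \<Rightarrow> real) \<Rightarrow> ennreal"
  assumes [measurable]: "f \<in> borel_measurable borel" "g \<in> borel_measurable (Pi\<^sub>M {0..} (\<lambda>_. borel))"
  shows "(\<integral>\<^sup>+\<omega>. f (T \<omega>) * g (\<lambda>t\<in>{0..}. X t \<omega>) \<partial>M) =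
    (\<integral>\<^sup>+\<omega>. f (T \<omega>) \<partial>M) * (\<integral>\<^sup>+\<omega>. g (\<lambda>t\<in>{0..}. X t \<omega>) \<partial>M)"
proof -
  let ?P = "\<lambda>\<omega>. \<lambda>t\<in>{0..}. X t \<omega>"
  have P [measurable]: "?P \<in> measurable M (Pi\<^sub>M {0..} (\<lambda>_. borel))"
    using T_indep by (simp add: indep_var_het_def)
  let ?A = "\<lambda>N Y. sigma_sets (space M) {Y -` A \<inter> space M | A. A \<in> sets N}"
  have sub: "?A borel (\<lambda>\<omega>. f (T \<omega>)) \<subseteq> ?A borel T"
    "?A borel (\<lambda>\<omega>. g (?P \<omega>)) \<subseteq> ?A (Pi\<^sub>M {0..} (\<lambda>_. borel)) ?P"
    by (intro sigma_sets_vimage_comp_subset assms T_measurable P)+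
  have "indep_set (?A borel T) (?A (Pi\<^sub>M {0..} (\<lambda>_. borel)) ?P)"
    using T_indep by (simp add: indep_var_het_def)
  then have "indep_set (?A borel (\<lambda>\<omega>. f (T \<omega>))) (?A borel (\<lambda>\<omega>. g (?P \<omega>)))"
    using sub unfolding indep_sets2_eq by blast
  then have "indep_var borel (\<lambda>\<omega>. f (T \<omega>)) borel (\<lambda>\<omega>. g (?P \<omega>))"
    unfolding indep_var_eq by simp
  then have "indep_vars (\<lambda>_. borel) (case_bool (\<lambda>\<omega>. f (T \<omega>)) (\<lambda>\<omega>. g (?P \<omega>))) UNIV"
    unfolding indep_var_def
    by (rule back_subst[where P = "\<lambda>N. indep_vars N _ UNIV"]) (auto split: bool.split)
  from indep_vars_nn_integral[OF _ this]
  show ?thesis by (simp add: UNIV_bool mult.commute)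
qed

lemma prob_grid_index:
  assumes h: "h > 0"
  shows "emeasure M {\<omega> \<in> space M. grid_index h (T \<omega>) = Suc k} =
    ennreal ((1 - exp (- \<theta> * h)) * exp (- \<theta> * h) ^ k)"
proof -
  let ?q = "exp (- \<theta> * h)"
  have le: "prob {\<omega> \<in> space M. grid_index h (T \<omega>) \<le> Suc k} = 1 - ?q ^ Suc k" for k
  proof -
    have "prob {\<omega> \<in> space M. grid_index h (T \<omega>) \<le> Suc k} = prob {\<omega> \<in> space M. T \<omega> \<le> h * Suc k}"
      by (simp only: grid_index_le_iff[OF h])
    also have "\<dots> = 1 - exp (- (h * Suc k) * \<theta>)"
      using h by (intro exponential_distributedD_le[OF T_exp _ theta]) simp
    also have "exp (- (h * Suc k) * \<theta>) = ?q ^ Suc k"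
      by (simp only: exp_of_nat_mult[symmetric]) (simp add: algebra_simps)
    finally show ?thesis .
  qed
  have [measurable]: "(\<lambda>\<omega>. grid_index h (T \<omega>)) \<in> measurable M (count_space UNIV)"
    unfolding grid_index_def by measurable
  have "prob {\<omega> \<in> space M. grid_index h (T \<omega>) = Suc k} = (1 - ?q) * ?q ^ k"
  proof (cases k)
    case 0
    have "{\<omega> \<in> space M. grid_index h (T \<omega>) = Suc k} = {\<omega> \<in> space M. grid_index h (T \<omega>) \<le> Suc 0}"
      using 0 by (auto simp: grid_index_def)
    then show ?thesis using le[of 0] 0 by simp
  next
    case (Suc j)
    have "{\<omega> \<in> space M. grid_index h (T \<omega>) = Suc k} =
      {\<omega> \<in> space M. grid_index h (T \<omega>) \<le> Suc k} - {\<omega> \<in> space M. grid_index h (T \<omega>) \<le> Suc j}"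
      using Suc by auto
    also have "prob \<dots> = prob {\<omega> \<in> space M. grid_index h (T \<omega>) \<le> Suc k} -
        prob {\<omega> \<in> space M. grid_index h (T \<omega>) \<le> Suc j}"
      using Suc by (intro finite_measure_Diff) auto
    finally show ?thesis unfolding le using Suc by (simp add: algebra_simps)
  qed
  then show ?thesis by (simp only: emeasure_eq_measure)
qed


text \<open>
  The index of the first grid point not before \<open>T\<close> is geometric on \<open>{1, 2, \<dots>}\<close>, not on \<open>{0, 1, \<dots>}\<close>. Shifting the
  series by one step turns one into the other at the price of a term of weight \<open>1 - q\<close>, which
  vanishes as \<open>h\<close> tends to \<open>0\<close>.
\<close>

lemma geom_mean_grid:
  assumes h: "h > 0" and \<Phi> [measurable]: "\<And>k. (\<lambda>p. \<Phi> (\<lambda>r. p (h * real r)) k) \<in> borel_measurable (Pi\<^sub>M {0..} (\<lambda>_. borel))"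
  defines "q \<equiv> exp (- \<theta> * h)"
  shows "random_walk.geom_mean M (\<lambda>k \<omega>. X (h * real k) \<omega>) q \<Phi> =
    ennreal (1 - q) * (\<integral>\<^sup>+\<omega>. \<Phi> (\<lambda>r. X (h * real r) \<omega>) 0 \<partial>M) +
    ennreal q * (\<integral>\<^sup>+\<omega>. \<Phi> (\<lambda>r. X (h * real r) \<omega>) (grid_index h (T \<omega>)) \<partial>M)"
proof -
  interpret W: random_walk M "\<lambda>k \<omega>. X (h * real k) \<omega>" "distr M borel (\<lambda>\<omega>. X h \<omega> - X 0 \<omega>)"
    by (rule random_walk_grid[OF h])
  let ?P = "\<lambda>\<omega>. \<lambda>t\<in>{0..}. X t \<omega>"
  let ?\<Phi> = "\<lambda>k \<omega>. \<Phi> (\<lambda>r. X (h * real r) \<omega>) k"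
  have P [measurable]: "?P \<in> measurable M (Pi\<^sub>M {0..} (\<lambda>_. borel))"
    using T_indep by (simp add: indep_var_het_def)
  have \<Phi>P: "?\<Phi> k \<omega> = \<Phi> (\<lambda>r. ?P \<omega> (h * real r)) k" for k \<omega>
    using h by simp
  have [measurable]: "?\<Phi> k \<in> borel_measurable M" for k
    unfolding \<Phi>P by measurable
  have q: "0 < q" "q < 1" using h theta by (auto simp: q_def)
  let ?e = "\<lambda>k. \<integral>\<^sup>+\<omega>. ?\<Phi> k \<omega> \<partial>M"
  have "(\<integral>\<^sup>+\<omega>. ?\<Phi> (grid_index h (T \<omega>)) \<omega> \<partial>M) =
    (\<integral>\<^sup>+\<omega>. (\<Sum>k. indicator {t. grid_index h t = Suc k} (T \<omega>) * ?\<Phi> (Suc k) \<omega>) \<partial>M)"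
  proof (intro nn_integral_cong)
    fix \<omega>
    obtain j where j: "grid_index h (T \<omega>) = Suc j" by (simp add: grid_index_def)
    have "(\<Sum>k. indicator {t. grid_index h t = Suc k} (T \<omega>) * ?\<Phi> (Suc k) \<omega>) =
      (\<Sum>k\<in>{j}. indicator {t. grid_index h t = Suc k} (T \<omega>) * ?\<Phi> (Suc k) \<omega>)"
      by (rule suminf_finite) (auto simp: j)
    then show "?\<Phi> (grid_index h (T \<omega>)) \<omega> =
      (\<Sum>k. indicator {t. grid_index h t = Suc k} (T \<omega>) * ?\<Phi> (Suc k) \<omega>)"
      by (simp add: j)
  qed
  also have "\<dots> = (\<Sum>k. \<integral>\<^sup>+\<omega>. indicator {t. grid_index h t = Suc k} (T \<omega>) * ?\<Phi> (Suc k) \<omega> \<partial>M)"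
    unfolding grid_index_def by (intro nn_integral_suminf) measurable
  also have "\<dots> = (\<Sum>k. ennreal (1 - q) * ennreal q ^ k * ?e (Suc k))"
  proof (rule suminf_cong)
    fix k
    have m: "{t. grid_index h t = Suc k} \<in> sets borel"
      unfolding grid_index_def by measurable
    have "(\<integral>\<^sup>+\<omega>. indicator {t. grid_index h t = Suc k} (T \<omega>) * ?\<Phi> (Suc k) \<omega> \<partial>M) =
      (\<integral>\<^sup>+\<omega>. indicator {t. grid_index h t = Suc k} (T \<omega>) \<partial>M) * ?e (Suc k)"
      unfolding \<Phi>P using m by (intro nn_integral_indep) auto
    also have "(\<integral>\<^sup>+\<omega>. indicator {t. grid_index h t = Suc k} (T \<omega>) \<partial>M) =
      emeasure M {\<omega> \<in> space M. grid_index h (T \<omega>) = Suc k}"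
    proof -
      have "(\<integral>\<^sup>+\<omega>. indicator {t. grid_index h t = Suc k} (T \<omega>) \<partial>M) =
        (\<integral>\<^sup>+\<omega>. indicator {\<omega> \<in> space M. grid_index h (T \<omega>) = Suc k} \<omega> \<partial>M)"
        by (intro nn_integral_cong) (auto simp: indicator_def)
      then show ?thesis unfolding grid_index_def by simp
    qed
    also have "\<dots> = ennreal (1 - q) * ennreal q ^ k"
      unfolding prob_grid_index[OF h] q_def[symmetric] using q by (simp add: ennreal_mult ennreal_power)
    finally show "(\<integral>\<^sup>+\<omega>. indicator {t. grid_index h t = Suc k} (T \<omega>) * ?\<Phi> (Suc k) \<omega> \<partial>M) =
      ennreal (1 - q) * ennreal q ^ k * ?e (Suc k)" .
  qed
  finally have "ennreal q * (\<integral>\<^sup>+\<omega>. ?\<Phi> (grid_index h (T \<omega>)) \<omega> \<partial>M) =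
    ennreal q * (\<Sum>k. ennreal (1 - q) * ennreal q ^ k * ?e (Suc k))" by simp
  also have "\<dots> = (\<Sum>k. ennreal q * (ennreal (1 - q) * ennreal q ^ k * ?e (Suc k)))"
    by (rule ennreal_suminf_cmult[symmetric])
  also have "\<dots> = (\<Sum>k. ennreal (1 - q) * ennreal q ^ Suc k * ?e (Suc k))"
    by (rule suminf_cong) (simp add: ac_simps)
  finally have "ennreal q * (\<integral>\<^sup>+\<omega>. ?\<Phi> (grid_index h (T \<omega>)) \<omega> \<partial>M) =
    (\<Sum>k. ennreal (1 - q) * ennreal q ^ Suc k * ?e (Suc k))" .
  then have "(\<lambda>k. ennreal (1 - q) * ennreal q ^ Suc k * ?e (Suc k)) sums
    (ennreal q * (\<integral>\<^sup>+\<omega>. ?\<Phi> (grid_index h (T \<omega>)) \<omega> \<partial>M))"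
    using summable_sums[of "\<lambda>k. ennreal (1 - q) * ennreal q ^ Suc k * ?e (Suc k)"] by simp
  from sums_Suc[OF this]
  have "(\<Sum>k. ennreal (1 - q) * ennreal q ^ k * ?e k) =
    ennreal (1 - q) * ?e 0 + ennreal q * (\<integral>\<^sup>+\<omega>. ?\<Phi> (grid_index h (T \<omega>)) \<omega> \<partial>M)"
    by (simp add: sums_iff add.commute)
  moreover have "W.geom_mean q \<Phi> = (\<Sum>k. ennreal (1 - q) * ennreal q ^ k * ?e k)"
    unfolding W.geom_mean_def nn_integral_count_space_nat
    by (subst nn_integral_suminf) (simp_all add: nn_integral_cmult)
  ultimately show ?thesis by simp
qed

end

section \<open>Corners of the convex minorant up to an exponential time\<close>

context levy_exponential_time
begin

definition min_time :: "real \<Rightarrow> 'a \<Rightarrow> real" where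
  "min_time s \<omega> = inf_time (\<lambda>t. X t \<omega> - s * t) (T \<omega>)"

text \<open>
  The path or its left limit at the first minimiser, without the drift.
\<close>

definition min_value :: "real \<Rightarrow> 'a \<Rightarrow> real" where
  "min_value s \<omega> = running_inf (\<lambda>t. X t \<omega> - s * t) (T \<omega>) + s * min_time s \<omega>"

definition unique_minimiser :: "real \<Rightarrow> 'a \<Rightarrow> bool" where
  "unique_minimiser s \<omega> \<longleftrightarrow> argmins (\<lambda>t. X t \<omega> - s * t) (T \<omega>) = {min_time s \<omega>}"

lemma min_time_measurable [measurable]: "min_time s \<in> borel_measurable M"
  using measurable_inf_time[OF T_measurable T_nonneg, of s] by (simp add: min_time_def[abs_def])

lemma min_value_measurable [measurable]: "min_value s \<in> borel_measurable M"
proof -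
  have [measurable]: "(\<lambda>\<omega>. running_inf (\<lambda>t. X t \<omega> - s * t) (T \<omega>)) \<in> borel_measurable M"
    by (intro measurable_running_inf T_measurable T_nonneg)
  show ?thesis unfolding min_value_def[abs_def] by measurable
qed

lemma min_time_mono: "\<omega> \<in> space M \<Longrightarrow> s \<le> s' \<Longrightarrow> min_time s \<omega> \<le> min_time s' \<omega>"
  unfolding min_time_def by (intro inf_time_drift_mono cadlag_paths T_nonneg)

text \<open>
  The function \<open>g s = E arctan (min_time s)\<close> is monotone, so it has countably many discontinuities. At a
  point of continuity, \<open>min_time s'\<close> decreases to \<open>min_time s\<close> almost surely as \<open>s'\<close> decreases to \<open>s\<close>; and every
  minimiser for \<open>s\<close> lies between these two times. The arc tangent only serves to have finite
  expectations.
\<close>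

lemma countable_nonunique_slopes: "countable {s. \<not> (AE \<omega> in M. unique_minimiser s \<omega>)}"
proof -
  define g where "g s = expectation (\<lambda>\<omega>. arctan (min_time s \<omega>))" for s
  have m [measurable]: "(\<lambda>\<omega>. arctan (min_time s \<omega>)) \<in> borel_measurable M" for s
    by (rule measurable_compose[OF min_time_measurable])
      (intro borel_measurable_continuous_onI continuous_intros)
  have bound: "\<bar>arctan x\<bar> \<le> 2" for x
    using arctan_bounded[of x] pi_half_less_two by auto
  have int [simp]: "integrable M (\<lambda>\<omega>. arctan (min_time s \<omega>))" for s
    using bound by (intro integrable_const_bound[where B = 2]) auto
  have "mono g"
    unfolding mono_def g_def
    by (intro allI impI integral_mono) (auto intro!: min_time_mono simp: arctan_le_iff)
  then have "countable {s. \<not> isCont g s}" by (rule mono_ctble_discont)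
  moreover have "AE \<omega> in M. unique_minimiser s \<omega>" if cont: "isCont g s" for s
  proof -
    define e where "e k = inverse (real (Suc k))" for k
    have e: "e k > 0" for k by (simp add: e_def)
    \<comment> \<open>The limit of the times from the right, which exists by monotonicity.\<close>
    define U where "U \<omega> = (INF k. arctan (min_time (s + e k) \<omega>))" for \<omega>
    have bdd: "bdd_below (range (\<lambda>k. arctan (min_time (s + e k) \<omega>)))" for \<omega>
      using bound by (intro bdd_belowI[of _ "-2"]) (auto simp: abs_le_iff minus_le_iff)
    have U_le: "U \<omega> \<le> arctan (min_time (s + e k) \<omega>)" for \<omega> k
      unfolding U_def by (intro cINF_lower bdd) simp
    have le_U: "c \<le> U \<omega>" if "\<And>k. c \<le> arctan (min_time (s + e k) \<omega>)" for c \<omega>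
      unfolding U_def using that by (intro cINF_greatest) auto
    have ge: "arctan (min_time s \<omega>) \<le> U \<omega>" if "\<omega> \<in> space M" for \<omega>
      using that e by (intro le_U) (auto intro!: min_time_mono simp: arctan_le_iff less_imp_le)
    have [measurable]: "U \<in> borel_measurable M"
      unfolding U_def[abs_def] by (rule borel_measurable_cINF) (auto intro: bdd)
    have "\<bar>U \<omega>\<bar> \<le> 2" if "\<omega> \<in> space M" for \<omega>
      using ge[OF that] U_le[of \<omega> 0] bound[of "min_time s \<omega>"] bound[of "min_time (s + e 0) \<omega>"] by linarith
    then have U_int [simp]: "integrable M U"
      by (intro integrable_const_bound[where B = 2]) auto
    have "expectation U \<le> g s"
    proof (rule LIMSEQ_le_const)
      have "e \<longlonglongrightarrow> 0" unfolding e_def[abs_def] by (rule LIMSEQ_inverse_real_of_nat)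
      then have "(\<lambda>k. s + e k) \<longlonglongrightarrow> s + 0" by (intro tendsto_intros)
      then show "(\<lambda>k. g (s + e k)) \<longlonglongrightarrow> g s"
        using isCont_tendsto_compose[OF cont] by simp
      show "\<exists>N. \<forall>k\<ge>N. expectation U \<le> g (s + e k)"
        unfolding g_def using U_le by (intro exI[of _ 0] allI impI integral_mono) auto
    qed
    then have "expectation (\<lambda>\<omega>. U \<omega> - arctan (min_time s \<omega>)) \<le> 0" by (simp add: g_def)
    moreover have "0 \<le> expectation (\<lambda>\<omega>. U \<omega> - arctan (min_time s \<omega>))"
      using ge by (intro integral_nonneg_AE AE_I2) simp
    ultimately have "expectation (\<lambda>\<omega>. U \<omega> - arctan (min_time s \<omega>)) = 0" by simp
    then have "AE \<omega> in M. U \<omega> - arctan (min_time s \<omega>) = 0"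
      using ge by (subst (asm) integral_nonneg_eq_0_iff_AE) auto
    then show ?thesis
    proof (rule AE_mp, intro AE_I2 impI)
      fix \<omega> assume \<omega>: "\<omega> \<in> space M" and eq: "U \<omega> - arctan (min_time s \<omega>) = 0"
      note x = cadlag_paths[OF \<omega>] and T = T_nonneg[OF \<omega>]
      have in_A: "min_time s' \<omega> \<in> argmins (\<lambda>t. X t \<omega> - s' * t) (T \<omega>)" for s'
        unfolding min_time_def by (rule inf_time_in_argmins[OF cadlag_drift[OF x] T])
      have "a = min_time s \<omega>" if a: "a \<in> argmins (\<lambda>t. X t \<omega> - s * t) (T \<omega>)" for a
      proof (rule antisym)
        show "min_time s \<omega> \<le> a" unfolding min_time_def by (rule inf_time_le[OF a])
        have "a \<le> min_time (s + e k) \<omega>" for k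
          by (rule argmins_drift_mono[OF x _ in_A a]) (simp add: e)
        then have "arctan a \<le> U \<omega>" by (intro le_U) (simp add: arctan_le_iff)
        then show "a \<le> min_time s \<omega>" using eq by (simp add: arctan_le_iff)
      qed
      then show "unique_minimiser s \<omega>" using in_A by (auto simp: unique_minimiser_def)
    qed
  qed
  ultimately show ?thesis by (auto elim: countable_subset[rotated])
qed

text \<open>
  Indices \<open>0\<close> and \<open>Suc n\<close> stand for the end points \<open>(0, 0)\<close> and \<open>(T, X\<^sub>T)\<close>, as in \<open>breakpoint\<close>.
\<close>

definition corner_time :: "nat \<Rightarrow> (nat \<Rightarrow> real) \<Rightarrow> nat \<Rightarrow> 'a \<Rightarrow> real" where
  "corner_time n s i \<omega> = (if i = 0 then 0 else if i \<le> n then min_time (s i) \<omega> else T \<omega>)"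

definition corner_value :: "nat \<Rightarrow> (nat \<Rightarrow> real) \<Rightarrow> nat \<Rightarrow> 'a \<Rightarrow> real" where
  "corner_value n s i \<omega> = (if i = 0 then 0 else if i \<le> n then min_value (s i) \<omega> else X (T \<omega>) \<omega>)"

definition corner_increment :: "nat \<Rightarrow> (nat \<Rightarrow> real) \<Rightarrow> nat \<Rightarrow> 'a \<Rightarrow> real \<times> real" where
  "corner_increment n s i \<omega> = (corner_time n s (Suc i) \<omega> - corner_time n s i \<omega>,
     corner_value n s (Suc i) \<omega> - corner_value n s i \<omega>)"

lemma corner_increment_measurable [measurable]: "corner_increment n s i \<in> borel_measurable M"
proof -
  have [measurable]: "corner_time n s i \<in> borel_measurable M" "corner_value n s i \<in> borel_measurable M" for i
    using measurable_at_random_time[OF T_measurable T_nonneg]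
    by (auto simp: corner_time_def[abs_def] corner_value_def[abs_def])
  show ?thesis unfolding corner_increment_def[abs_def] by (intro borel_measurable_Pair) measurable
qed

text \<open>
  The product of test functions of the displacements between the cuts of the walk on the grid. The
  slope per step is \<open>s i * h\<close>, and lengths are multiplied by \<open>h\<close> to become times.
\<close>

definition grid_prod ::
    "nat \<Rightarrow> (nat \<Rightarrow> real) \<Rightarrow> (nat \<Rightarrow> real \<times> real \<Rightarrow> real) \<Rightarrow> real \<Rightarrow> nat \<Rightarrow> 'a \<Rightarrow> real" where
  "grid_prod n s F h k \<omega> = (\<Prod>i\<le>n. let b = breakpoint (\<lambda>i. s i * h) n (\<lambda>r. X (h * real r) \<omega>) k in
     F i (h * real (b (Suc i) - b i), X (h * real (b (Suc i))) \<omega> - X (h * real (b i)) \<omega>))"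

text \<open>
  By \<open>geom_mean_grid\<close>, this is the mean of \<open>grid_prod\<close> at a geometric time on \<open>{0, 1, \<dots>}\<close>; in this form its
  limit is visible.
\<close>

definition grid_mean :: "nat \<Rightarrow> (nat \<Rightarrow> real) \<Rightarrow> (nat \<Rightarrow> real \<times> real \<Rightarrow> real) \<Rightarrow> real \<Rightarrow> real" where
  "grid_mean n s F h = (1 - exp (- \<theta> * h)) * expectation (grid_prod n s F h 0) +
     exp (- \<theta> * h) * expectation (\<lambda>\<omega>. grid_prod n s F h (grid_index h (T \<omega>)) \<omega>)"

context
  fixes n :: nat and s :: "nat \<Rightarrow> real"
  assumes s_mono: "mono_on {1..n} s"
begin

lemma corner_prod_eq_grid_prod:
  assumes "\<And>i x. F i x \<in> {0..1}"
  shows "corner_prod (\<lambda>i. s i * h) n (\<lambda>i l d. ennreal (F i (h * real l, d))) (\<lambda>r. X (h * real r) \<omega>) k =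
    ennreal (grid_prod n s F h k \<omega>)"
  using assms by (simp add: corner_prod_def grid_prod_def prod_ennreal Let_def)

lemma grid_prod_range:
  assumes "\<And>i x. F i x \<in> {0..1}"
  shows "0 \<le> grid_prod n s F h k \<omega>" "grid_prod n s F h k \<omega> \<le> 1"
  using assms by (auto simp: grid_prod_def Let_def intro!: prod_nonneg prod_le_1)

lemma grid_prod_measurable:
  assumes F: "\<And>i. continuous_on UNIV (F i)" "\<And>i x. F i x \<in> {0..1}" and h: "h > 0"
  shows "grid_prod n s F h k \<in> borel_measurable M"
    "(\<lambda>\<omega>. grid_prod n s F h (grid_index h (T \<omega>)) \<omega>) \<in> borel_measurable M"
proof -
  show *: "grid_prod n s F h k \<in> borel_measurable M" for k
  proof -
    have "(\<lambda>\<omega>. corner_prod (\<lambda>i. s i * h) n (\<lambda>i l d. ennreal (F i (h * real l, d)))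
        (\<lambda>r. X (h * real r) \<omega>) k) \<in> borel_measurable M"
    proof (rule measurable_corner_prod)
      show "(\<lambda>\<omega>. X (h * real r) \<omega>) \<in> borel_measurable M" for r
        using h by (intro random_variable_X) simp
    qed (rule section_measurable[OF F(1)])
    then have "(\<lambda>\<omega>. enn2real (ennreal (grid_prod n s F h k \<omega>))) \<in> borel_measurable M"
      unfolding corner_prod_eq_grid_prod[where F = F, OF F(2)] by measurable
    then show ?thesis by (simp add: grid_prod_range[where F = F, OF F(2)])
  qed
  have "(\<lambda>\<omega>. grid_index h (T \<omega>)) \<in> measurable M (count_space UNIV)"
    unfolding grid_index_def by measurable
  then show "(\<lambda>\<omega>. grid_prod n s F h (grid_index h (T \<omega>)) \<omega>) \<in> borel_measurable M"
    by (rule measurable_compose_countable[OF *])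
qed

lemma geom_mean_eq_grid_mean:
  assumes F: "\<And>i. continuous_on UNIV (F i)" "\<And>i x. F i x \<in> {0..1}" and h: "h > 0"
  shows "random_walk.geom_mean M (\<lambda>k \<omega>. X (h * real k) \<omega>) (exp (- \<theta> * h))
     (corner_prod (\<lambda>i. s i * h) n (\<lambda>i l d. ennreal (F i (h * real l, d)))) = ennreal (grid_mean n s F h)"
    and "0 \<le> grid_mean n s F h"
proof -
  let ?\<Phi> = "corner_prod (\<lambda>i. s i * h) n (\<lambda>i l d. ennreal (F i (h * real l, d)))"
  note range = grid_prod_range[where F = F, OF F(2)]
  have q: "exp (- \<theta> * h) \<le> 1" using theta h by simp
  have int: "integrable M (grid_prod n s F h 0)"
    "integrable M (\<lambda>\<omega>. grid_prod n s F h (grid_index h (T \<omega>)) \<omega>)"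
    using range by (auto intro!: integrable_const_bound[where B = 1] grid_prod_measurable F h)
  have nonneg: "0 \<le> expectation (grid_prod n s F h 0)"
    "0 \<le> expectation (\<lambda>\<omega>. grid_prod n s F h (grid_index h (T \<omega>)) \<omega>)"
    using range by (auto intro!: integral_nonneg)
  show "0 \<le> grid_mean n s F h"
    using nonneg q by (simp add: grid_mean_def)
  have "(\<lambda>p. ?\<Phi> (\<lambda>r. p (h * real r)) k) \<in> borel_measurable (Pi\<^sub>M {0..} (\<lambda>_. borel))" for k
    using h by (intro measurable_corner_prod section_measurable F(1) measurable_component_singleton) simp
  from geom_mean_grid[OF h this]
  have "random_walk.geom_mean M (\<lambda>k \<omega>. X (h * real k) \<omega>) (exp (- \<theta> * h)) ?\<Phi> =
    ennreal (1 - exp (- \<theta> * h)) * (\<integral>\<^sup>+\<omega>. ennreal (grid_prod n s F h 0 \<omega>) \<partial>M) +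
    ennreal (exp (- \<theta> * h)) * (\<integral>\<^sup>+\<omega>. ennreal (grid_prod n s F h (grid_index h (T \<omega>)) \<omega>) \<partial>M)"
    by (simp only: corner_prod_eq_grid_prod[where F = F, OF F(2)])
  also have "\<dots> = ennreal (grid_mean n s F h)"
    using nonneg q int range
    by (simp add: nn_integral_eq_integral grid_mean_def ennreal_mult ennreal_plus)
  finally show "random_walk.geom_mean M (\<lambda>k \<omega>. X (h * real k) \<omega>) (exp (- \<theta> * h)) ?\<Phi> =
    ennreal (grid_mean n s F h)" .
qed

lemma grid_mean_factorises:
  assumes F: "\<And>i. continuous_on UNIV (F i)" "\<And>i x. F i x \<in> {0..1}" and h: "h > 0"
  shows "grid_mean n s F h = (\<Prod>i\<le>n. grid_mean n s (\<lambda>j. if j = i then F i else (\<lambda>_. 1)) h)"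
proof -
  interpret W: random_walk M "\<lambda>k \<omega>. X (h * real k) \<omega>" "distr M borel (\<lambda>\<omega>. X h \<omega> - X 0 \<omega>)"
    by (rule random_walk_grid[OF h])
  let ?G = "\<lambda>i j. if j = i then F i else (\<lambda>_. 1)"
  have G: "continuous_on UNIV (?G i j)" "?G i j x \<in> {0..1}" for i j x
    using F by auto
  have \<sigma>: "mono_on {1..n} (\<lambda>i. s i * h)"
    using s_mono h by (auto simp: mono_on_def intro!: mult_right_mono)
  have q: "0 \<le> exp (- \<theta> * h)" "exp (- \<theta> * h) < 1" using theta h by auto
  let ?f = "\<lambda>i l d. ennreal (F i (h * real l, d))"
  have "ennreal (grid_mean n s F h) = W.geom_mean (exp (- \<theta> * h)) (corner_prod (\<lambda>i. s i * h) n ?f)"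
    by (simp only: geom_mean_eq_grid_mean[where F = F, OF F h])
  also have "\<dots> = (\<Prod>i\<le>n. W.geom_mean (exp (- \<theta> * h))
      (corner_prod (\<lambda>i. s i * h) n (\<lambda>j. if j = i then ?f i else (\<lambda>_ _. 1))))"
    by (rule W.geom_mean_corner_prod[OF \<sigma> section_measurable[OF F(1)] q])
  also have "\<dots> = (\<Prod>i\<le>n. ennreal (grid_mean n s (?G i) h))"
  proof (rule prod.cong[OF refl])
    fix i
    have "(\<lambda>j. if j = i then ?f i else (\<lambda>_ _. 1)) = (\<lambda>j l d. ennreal (?G i j (h * real l, d)))"
      by (auto simp: fun_eq_iff)
    then show "W.geom_mean (exp (- \<theta> * h)) (corner_prod (\<lambda>i. s i * h) n (\<lambda>j. if j = i then ?f i else (\<lambda>_ _. 1))) =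
      ennreal (grid_mean n s (?G i) h)"
      by (simp only: geom_mean_eq_grid_mean[where F = "?G i", OF G h])
  qed
  also have "\<dots> = ennreal (\<Prod>i\<le>n. grid_mean n s (?G i) h)"
    by (intro prod_ennreal geom_mean_eq_grid_mean(2) G h)
  finally have "ennreal (grid_mean n s F h) = ennreal (\<Prod>i\<le>n. grid_mean n s (?G i) h)" .
  moreover have "0 \<le> grid_mean n s F h"
    by (rule geom_mean_eq_grid_mean(2)[where F = F, OF F h])
  moreover have "0 \<le> (\<Prod>i\<le>n. grid_mean n s (?G i) h)"
    by (intro prod_nonneg ballI geom_mean_eq_grid_mean(2) G h)
  ultimately show ?thesis by (simp only: ennreal_inj)
qed

text \<open>
  The cuts of the walk are minimisers over the grid, so their values converge to the infimum and, the
  minimiser being unique, the cuts themselves converge to it.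
\<close>

lemma grid_prod_tendsto:
  assumes F: "\<And>i. continuous_on UNIV (F i)"
    and h: "\<And>N. h N > 0" "h \<longlonglongrightarrow> 0" and \<omega>: "\<omega> \<in> space M"
    and uniq: "\<And>i. i \<in> {1..n} \<Longrightarrow> unique_minimiser (s i) \<omega>"
  shows "(\<lambda>N. grid_prod n s F (h N) (grid_index (h N) (T \<omega>)) \<omega>) \<longlonglongrightarrow>
    (\<Prod>i\<le>n. F i (corner_increment n s i \<omega>))"
proof -
  note x = cadlag_paths[OF \<omega>] and T = T_nonneg[OF \<omega>]
  define K where "K N = grid_index (h N) (T \<omega>)" for N
  have K: "T \<omega> \<le> h N * K N" "h N * K N \<le> T \<omega> + h N" for N
    using grid_index_bounds[OF h(1) T] by (auto simp: K_def)
  have hK: "(\<lambda>N. h N * K N) \<longlonglongrightarrow> T \<omega>"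
  proof (rule tendsto_sandwich)
    show "eventually (\<lambda>N. T \<omega> \<le> h N * K N) sequentially"
      "eventually (\<lambda>N. h N * K N \<le> T \<omega> + h N) sequentially"
      using K by (auto intro: always_eventually)
    have "(\<lambda>N. T \<omega> + h N) \<longlonglongrightarrow> T \<omega> + 0" by (intro tendsto_intros h)
    then show "(\<lambda>N. T \<omega> + h N) \<longlonglongrightarrow> T \<omega>" by simp
  qed simp
  define b where "b N i = breakpoint (\<lambda>i. s i * h N) n (\<lambda>r. X (h N * real r) \<omega>) (K N) i" for N i
  have lim: "(\<lambda>N. h N * b N i) \<longlonglongrightarrow> corner_time n s i \<omega> \<and>
    (\<lambda>N. X (h N * b N i) \<omega>) \<longlonglongrightarrow> corner_value n s i \<omega>" if i: "i \<le> Suc n" for i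
  proof -
    consider "i = 0" | "i = Suc n" | "i \<in> {1..n}" using i by fastforce
    then show ?thesis
    proof cases
      case 1
      then show ?thesis using start_zero[OF \<omega>]
        by (simp add: b_def breakpoint_def corner_time_def corner_value_def)
    next
      case 2
      then show ?thesis using hK cadlag_tendsto_from_right[OF x T K(1) hK]
        by (simp add: b_def breakpoint_def corner_time_def corner_value_def)
    next
      case 3
      let ?y = "\<lambda>t. X t \<omega> - s i * t"
      have bi: "b N i = first_min (s i * h N) (\<lambda>r. X (h N * real r) \<omega>) (K N)" for N
        using 3 by (simp add: b_def breakpoint_def)
      have y_lim: "(\<lambda>N. ?y (h N * b N i)) \<longlonglongrightarrow> running_inf ?y (T \<omega>)"
      proof (rule grid_minimum_tendsto[OF cadlag_drift[OF x] T h K])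
        show "b N i \<le> K N" for N unfolding bi by (rule first_min_le)
        show "?y (h N * b N i) \<le> ?y (h N * real r)" if "r \<le> K N" for N r
          using first_min_minimal[OF that, of "\<lambda>r. X (h N * real r) \<omega>" "s i * h N"]
          unfolding bi by (simp add: mult.assoc)
      qed
      have t_lim: "(\<lambda>N. h N * b N i) \<longlonglongrightarrow> min_time (s i) \<omega>"
      proof (rule tendsto_unique_argmin[OF cadlag_drift[OF x] _ _ _ hK y_lim])
        show "argmins ?y (T \<omega>) = {min_time (s i) \<omega>}"
          using uniq[OF 3] by (simp add: unique_minimiser_def)
        show "0 \<le> h N * b N i" "h N * b N i \<le> h N * K N" for N
          using h(1)[of N] first_min_le[of "s i * h N" "\<lambda>r. X (h N * real r) \<omega>" "K N"]
          by (auto simp: bi)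
      qed
      have "(\<lambda>N. ?y (h N * b N i) + s i * (h N * b N i)) \<longlonglongrightarrow>
        running_inf ?y (T \<omega>) + s i * min_time (s i) \<omega>"
        by (intro tendsto_intros y_lim t_lim)
      then show ?thesis using t_lim 3 by (simp add: corner_time_def corner_value_def min_value_def)
    qed
  qed
  have mono: "b N i \<le> b N (Suc i)" if "i \<le> n" for N i
  proof -
    have "mono_on {1..n} (\<lambda>i. s i * h N)"
      using s_mono h(1)[of N] by (auto simp: mono_on_def intro!: mult_right_mono)
    then show ?thesis unfolding b_def by (rule breakpoint_mono[OF _ that])
  qed
  have "(\<lambda>N. \<Prod>i\<le>n. F i (h N * b N (Suc i) - h N * b N i, X (h N * b N (Suc i)) \<omega> - X (h N * b N i) \<omega>))
    \<longlonglongrightarrow> (\<Prod>i\<le>n. F i (corner_increment n s i \<omega>))"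
  proof (intro tendsto_prod)
    fix i assume i: "i \<in> {..n}"
    have "(\<lambda>N. (h N * b N (Suc i) - h N * b N i, X (h N * b N (Suc i)) \<omega> - X (h N * b N i) \<omega>))
      \<longlonglongrightarrow> corner_increment n s i \<omega>"
      unfolding corner_increment_def using lim[of i] lim[of "Suc i"] i
      by (intro tendsto_Pair tendsto_diff) auto
    moreover have "isCont (F i) z" for z
      using F[of i] by (cases z) (simp add: continuous_on_eq_continuous_at)
    ultimately show "(\<lambda>N. F i (h N * b N (Suc i) - h N * b N i, X (h N * b N (Suc i)) \<omega> - X (h N * b N i) \<omega>))
      \<longlonglongrightarrow> F i (corner_increment n s i \<omega>)"
      by (intro isCont_tendsto_compose[of _ "F i"])
  qed
  moreover have "grid_prod n s F (h N) (grid_index (h N) (T \<omega>)) \<omega> =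
    (\<Prod>i\<le>n. F i (h N * b N (Suc i) - h N * b N i, X (h N * b N (Suc i)) \<omega> - X (h N * b N i) \<omega>))" for N
    unfolding grid_prod_def Let_def K_def[symmetric] b_def[symmetric]
    using mono by (intro prod.cong) (auto simp: of_nat_diff right_diff_distrib)
  ultimately show ?thesis by simp
qed

lemma grid_mean_tendsto:
  assumes F: "\<And>i. continuous_on UNIV (F i)" "\<And>i x. F i x \<in> {0..1}"
    and h: "\<And>N. h N > 0" "h \<longlonglongrightarrow> 0"
    and uniq: "\<And>i. i \<in> {1..n} \<Longrightarrow> AE \<omega> in M. unique_minimiser (s i) \<omega>"
  shows "(\<lambda>N. grid_mean n s F (h N)) \<longlonglongrightarrow> expectation (\<lambda>\<omega>. \<Prod>i\<le>n. F i (corner_increment n s i \<omega>))"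
proof -
  note range = grid_prod_range[where F = F, OF F(2)]
  have Fm [measurable]: "F i \<in> borel_measurable borel" for i
    by (rule borel_measurable_continuous_onI[OF F(1)])
  have lim1: "(\<lambda>N. expectation (\<lambda>\<omega>. grid_prod n s F (h N) (grid_index (h N) (T \<omega>)) \<omega>)) \<longlonglongrightarrow>
    expectation (\<lambda>\<omega>. \<Prod>i\<le>n. F i (corner_increment n s i \<omega>))"
  proof (rule integral_dominated_convergence[where w = "\<lambda>_. 1"])
    have "AE \<omega> in M. \<forall>i\<in>{1..n}. unique_minimiser (s i) \<omega>"
      using uniq by (intro AE_finite_allI) auto
    then show "AE \<omega> in M. (\<lambda>N. grid_prod n s F (h N) (grid_index (h N) (T \<omega>)) \<omega>) \<longlonglongrightarrow>
      (\<Prod>i\<le>n. F i (corner_increment n s i \<omega>))"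
      by (rule AE_mp) (auto intro!: AE_I2 grid_prod_tendsto F h)
    show "AE \<omega> in M. norm (grid_prod n s F (h N) (grid_index (h N) (T \<omega>)) \<omega>) \<le> 1" for N
      using range by simp
    show "(\<lambda>\<omega>. grid_prod n s F (h N) (grid_index (h N) (T \<omega>)) \<omega>) \<in> borel_measurable M" for N
      by (intro grid_prod_measurable F h)
    show "(\<lambda>\<omega>. \<Prod>i\<le>n. F i (corner_increment n s i \<omega>)) \<in> borel_measurable M"
      by measurable
  qed simp
  have "(\<lambda>N. exp (- \<theta> * h N)) \<longlonglongrightarrow> exp (- \<theta> * 0)"
    by (intro tendsto_intros h)
  then have lim_q: "(\<lambda>N. exp (- \<theta> * h N)) \<longlonglongrightarrow> 1" by simp
  have lim0: "(\<lambda>N. (1 - exp (- \<theta> * h N)) * expectation (grid_prod n s F (h N) 0)) \<longlonglongrightarrow> 0"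
  proof (rule Lim_null_comparison)
    have "(\<lambda>N. 1 - exp (- \<theta> * h N)) \<longlonglongrightarrow> 1 - 1" by (intro tendsto_intros lim_q)
    then show "(\<lambda>N. 1 - exp (- \<theta> * h N)) \<longlonglongrightarrow> 0" by simp
    have "norm ((1 - exp (- \<theta> * h N)) * expectation (grid_prod n s F (h N) 0)) \<le> 1 - exp (- \<theta> * h N)" for N
    proof -
      have int: "integrable M (grid_prod n s F (h N) 0)"
        using range by (auto intro!: integrable_const_bound[where B = 1] grid_prod_measurable F h)
      have "expectation (grid_prod n s F (h N) 0) \<le> 1"
        using range by (intro integral_le_const int) auto
      moreover have "0 \<le> expectation (grid_prod n s F (h N) 0)"
        using range by (auto intro!: integral_nonneg)
      moreover have "0 \<le> 1 - exp (- \<theta> * h N)" using theta h(1)[of N] by simp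
      ultimately show ?thesis by (simp add: abs_mult mult_left_le)
    qed
    then show "eventually (\<lambda>N. norm ((1 - exp (- \<theta> * h N)) * expectation (grid_prod n s F (h N) 0))
      \<le> 1 - exp (- \<theta> * h N)) sequentially"
      by (intro always_eventually allI)
  qed
  from tendsto_add[OF lim0 tendsto_mult[OF lim_q lim1]]
  show ?thesis by (simp add: grid_mean_def)
qed

lemma expectation_corner_increments_generic:
  fixes F :: "nat \<Rightarrow> real \<times> real \<Rightarrow> real"
  assumes F: "\<And>i. continuous_on UNIV (F i)" "\<And>i x. F i x \<in> {0..1}"
    and uniq: "\<And>i. i \<in> {1..n} \<Longrightarrow> AE \<omega> in M. unique_minimiser (s i) \<omega>"
  shows "expectation (\<lambda>\<omega>. \<Prod>i\<le>n. F i (corner_increment n s i \<omega>)) =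
    (\<Prod>i\<le>n. expectation (\<lambda>\<omega>. F i (corner_increment n s i \<omega>)))"
proof -
  define h where "h N = inverse (real (Suc N))" for N
  have h: "h N > 0" "h \<longlonglongrightarrow> 0" for N
    unfolding h_def[abs_def] using LIMSEQ_inverse_real_of_nat by (auto simp del: of_nat_Suc)
  let ?G = "\<lambda>i j. if j = i then F i else (\<lambda>_. 1)"
  have G: "continuous_on UNIV (?G i j)" "?G i j x \<in> {0..1}" for i j x
    using F by auto
  have "(\<lambda>N. grid_mean n s (?G i) (h N)) \<longlonglongrightarrow> expectation (\<lambda>\<omega>. F i (corner_increment n s i \<omega>))"
    if "i \<in> {..n}" for i
  proof -
    have "(\<Prod>j\<le>n. ?G i j (corner_increment n s j \<omega>)) = F i (corner_increment n s i \<omega>)" for \<omega>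
      using that by (subst prod.remove[of _ i]) auto
    then show ?thesis using grid_mean_tendsto[of "?G i", OF G h uniq] by simp
  qed
  then have "(\<lambda>N. \<Prod>i\<le>n. grid_mean n s (?G i) (h N)) \<longlonglongrightarrow>
    (\<Prod>i\<le>n. expectation (\<lambda>\<omega>. F i (corner_increment n s i \<omega>)))"
    by (rule tendsto_prod)
  moreover have "(\<lambda>N. \<Prod>i\<le>n. grid_mean n s (?G i) (h N)) \<longlonglongrightarrow>
    expectation (\<lambda>\<omega>. \<Prod>i\<le>n. F i (corner_increment n s i \<omega>))"
    using grid_mean_tendsto[of F, OF F h uniq] by (simp add: grid_mean_factorises[of F, OF F h(1)])
  ultimately show ?thesis by (intro LIMSEQ_unique) simp_all
qed

end

text \<open>
  The \<open>i\<close>-th new slope is chosen strictly between \<open>s (i - 1)\<close> and \<open>s i\<close>, which preserves the order.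
\<close>

lemma exists_generic_slopes:
  fixes n :: nat and s :: "nat \<Rightarrow> real"
  assumes s: "strict_mono_on {1..n} s" and e: "e > 0"
  obtains r where "mono_on {1..n} r" "\<And>i. i \<in> {1..n} \<Longrightarrow> r i < s i" "\<And>i. i \<in> {1..n} \<Longrightarrow> s i - e < r i"
    "\<And>i. i \<in> {1..n} \<Longrightarrow> AE \<omega> in M. unique_minimiser (r i) \<omega>"
proof -
  \<comment> \<open>The first slope has no predecessor; \<open>s i - 1\<close> is an arbitrary smaller number.\<close>
  define l where "l i = max (s i - e) (if i = 1 then s i - 1 else s (i - 1))" for i
  have "\<exists>r. l i < r \<and> r < s i \<and> (AE \<omega> in M. unique_minimiser r \<omega>)" if i: "i \<in> {1..n}" for i
  proof -
    have "s (i - 1) < s i" if "i \<noteq> 1"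
      using i that by (intro strict_mono_onD[OF s]) auto
    then have "l i < s i" using e by (simp add: l_def)
    then have "uncountable ({l i<..<s i} - {r. \<not> (AE \<omega> in M. unique_minimiser r \<omega>)})"
      by (intro uncountable_minus_countable countable_nonunique_slopes)
        (simp add: uncountable_open_interval)
    then have "{l i<..<s i} - {r. \<not> (AE \<omega> in M. unique_minimiser r \<omega>)} \<noteq> {}"
      by (intro notI) simp
    then show ?thesis by auto
  qed
  then obtain r where r: "\<And>i. i \<in> {1..n} \<Longrightarrow> l i < r i" "\<And>i. i \<in> {1..n} \<Longrightarrow> r i < s i"
    "\<And>i. i \<in> {1..n} \<Longrightarrow> AE \<omega> in M. unique_minimiser (r i) \<omega>" by metis
  show thesis
  proof
    show "mono_on {1..n} r"
    proof (rule mono_onI)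
      fix i j assume ij: "i \<in> {1..n}" "j \<in> {1..n}" "i \<le> j"
      show "r i \<le> r j"
      proof (cases "i = j")
        case False
        then have "s i \<le> s (j - 1)"
          using ij by (intro strict_mono_on_leD[OF s]) auto
        also have "\<dots> \<le> l j" using False ij by (simp add: l_def)
        finally show ?thesis using r(2)[OF ij(1)] r(1)[OF ij(2)] by linarith
      qed simp
    qed
    show "s i - e < r i" if "i \<in> {1..n}" for i using r(1)[OF that] by (simp add: l_def)
  qed (use r in auto)
qed

lemma corner_increment_tendsto:
  assumes \<omega>: "\<omega> \<in> space M"
    and r: "\<And>i. i \<in> {1..n} \<Longrightarrow> (\<lambda>k. r k i) \<longlonglongrightarrow> s i" "\<And>k i. i \<in> {1..n} \<Longrightarrow> r k i \<le> s i"
    and i: "i \<le> n"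
  shows "(\<lambda>k. corner_increment n (r k) i \<omega>) \<longlonglongrightarrow> corner_increment n s i \<omega>"
proof -
  note x = cadlag_paths[OF \<omega>] and T = T_nonneg[OF \<omega>]
  have "(\<lambda>k. corner_time n (r k) j \<omega>) \<longlonglongrightarrow> corner_time n s j \<omega> \<and>
    (\<lambda>k. corner_value n (r k) j \<omega>) \<longlonglongrightarrow> corner_value n s j \<omega>" for j
  proof (cases "j \<in> {1..n}")
    case True
    have t: "(\<lambda>k. min_time (r k j) \<omega>) \<longlonglongrightarrow> min_time (s j) \<omega>"
      unfolding min_time_def by (rule inf_time_drift_left_continuous[OF x T r(1)[OF True] r(2)[OF True]])
    have "(\<lambda>k. min_value (r k j) \<omega>) \<longlonglongrightarrow> min_value (s j) \<omega>"
      unfolding min_value_def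
      by (intro tendsto_add tendsto_mult t r(1) running_inf_drift_tendsto[OF x T] True)
    with t True show ?thesis by (simp add: corner_time_def corner_value_def)
  qed (auto simp: corner_time_def corner_value_def)
  then show ?thesis
    unfolding corner_increment_def by (intro tendsto_Pair tendsto_diff) auto
qed

text \<open>
  Exceptional slopes are approximated from below by slopes with almost surely unique minimisers.
\<close>

lemma expectation_corner_increments:
  fixes F :: "nat \<Rightarrow> real \<times> real \<Rightarrow> real"
  assumes s: "strict_mono_on {1..n} s"
    and F: "\<And>i. continuous_on UNIV (F i)" "\<And>i x. F i x \<in> {0..1}"
  shows "expectation (\<lambda>\<omega>. \<Prod>i\<le>n. F i (corner_increment n s i \<omega>)) =
    (\<Prod>i\<le>n. expectation (\<lambda>\<omega>. F i (corner_increment n s i \<omega>)))"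
proof -
  have "\<exists>r. mono_on {1..n} r \<and> (\<forall>i\<in>{1..n}. r i < s i \<and> s i - inverse (real (Suc k)) < r i \<and>
    (AE \<omega> in M. unique_minimiser (r i) \<omega>))" for k
    using exists_generic_slopes[OF s, of "inverse (real (Suc k))"] by (metis inverse_positive_iff_positive of_nat_0_less_iff zero_less_Suc)
  then obtain r where r: "\<And>k. mono_on {1..n} (r k)" "\<And>k i. i \<in> {1..n} \<Longrightarrow> r k i < s i"
    "\<And>k i. i \<in> {1..n} \<Longrightarrow> s i - inverse (real (Suc k)) < r k i"
    "\<And>k i. i \<in> {1..n} \<Longrightarrow> AE \<omega> in M. unique_minimiser (r k i) \<omega>" by metis
  have r_lim: "(\<lambda>k. r k i) \<longlonglongrightarrow> s i" if "i \<in> {1..n}" for i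
  proof (rule tendsto_sandwich)
    show "eventually (\<lambda>k. s i - inverse (real (Suc k)) \<le> r k i) sequentially"
      "eventually (\<lambda>k. r k i \<le> s i) sequentially"
      using r(2,3)[OF that] by (auto intro!: always_eventually less_imp_le simp del: of_nat_Suc)
    have "(\<lambda>k. s i - inverse (real (Suc k))) \<longlonglongrightarrow> s i - 0"
      by (intro tendsto_intros LIMSEQ_inverse_real_of_nat)
    then show "(\<lambda>k. s i - inverse (real (Suc k))) \<longlonglongrightarrow> s i" by simp
  qed simp
  have F_lim: "(\<lambda>k. F i (corner_increment n (r k) i \<omega>)) \<longlonglongrightarrow> F i (corner_increment n s i \<omega>)"
    if "i \<le> n" "\<omega> \<in> space M" for i \<omega>
  proof -
    have "isCont (F i) z" for z
      using F(1)[of i] by (cases z) (simp add: continuous_on_eq_continuous_at)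
    then show ?thesis
      by (intro isCont_tendsto_compose[of _ "F i"] corner_increment_tendsto)
        (use that r(2) r_lim in \<open>auto intro: less_imp_le\<close>)
  qed
  have [measurable]: "F i \<in> borel_measurable borel" for i
    by (rule borel_measurable_continuous_onI[OF F(1)])
  have F_abs: "\<bar>F i x\<bar> \<le> 1" for i x using F(2)[of i x] by simp
  have 1: "(\<lambda>k. expectation (\<lambda>\<omega>. \<Prod>i\<le>n. F i (corner_increment n (r k) i \<omega>))) \<longlonglongrightarrow>
    expectation (\<lambda>\<omega>. \<Prod>i\<le>n. F i (corner_increment n s i \<omega>))"
  proof (rule integral_dominated_convergence[where w = "\<lambda>_. 1"])
    show "AE \<omega> in M. (\<lambda>k. \<Prod>i\<le>n. F i (corner_increment n (r k) i \<omega>)) \<longlonglongrightarrow>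
      (\<Prod>i\<le>n. F i (corner_increment n s i \<omega>))"
      using F_lim by (intro AE_I2 tendsto_prod) auto
    show "AE \<omega> in M. norm (\<Prod>i\<le>n. F i (corner_increment n (r k) i \<omega>)) \<le> 1" for k
      unfolding real_norm_def abs_prod by (intro AE_I2 prod_le_1 conjI F_abs abs_ge_zero)
  qed measurable
  have 2: "(\<lambda>k. \<Prod>i\<le>n. expectation (\<lambda>\<omega>. F i (corner_increment n (r k) i \<omega>))) \<longlonglongrightarrow>
    (\<Prod>i\<le>n. expectation (\<lambda>\<omega>. F i (corner_increment n s i \<omega>)))"
  proof (rule tendsto_prod)
    fix i assume i: "i \<in> {..n}"
    show "(\<lambda>k. expectation (\<lambda>\<omega>. F i (corner_increment n (r k) i \<omega>))) \<longlonglongrightarrow>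
      expectation (\<lambda>\<omega>. F i (corner_increment n s i \<omega>))"
    proof (rule integral_dominated_convergence[where w = "\<lambda>_. 1"])
      show "AE \<omega> in M. (\<lambda>k. F i (corner_increment n (r k) i \<omega>)) \<longlonglongrightarrow> F i (corner_increment n s i \<omega>)"
        using F_lim i by (intro AE_I2) auto
      show "AE \<omega> in M. norm (F i (corner_increment n (r k) i \<omega>)) \<le> 1" for k
        using F_abs by (intro AE_I2) auto
    qed measurable
  qed
  have "expectation (\<lambda>\<omega>. \<Prod>i\<le>n. F i (corner_increment n (r k) i \<omega>)) =
    (\<Prod>i\<le>n. expectation (\<lambda>\<omega>. F i (corner_increment n (r k) i \<omega>)))" for k
    by (rule expectation_corner_increments_generic[OF r(1) F r(4)])
  with 1 2 show ?thesis by (intro LIMSEQ_unique) simp_all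
qed

theorem indep_corner_increments:
  assumes s: "strict_mono_on {1..n} s"
  shows "indep_vars (\<lambda>_. borel) (corner_increment n s) {..n}"
  by (rule indep_vars_if_continuous_test_functions)
    (auto intro: expectation_corner_increments[OF s])

end

theorem corollary10:
  fixes M :: "'a measure" and X :: "real \<Rightarrow> 'a \<Rightarrow> real" and T :: "'a \<Rightarrow> real"
    and \<theta> :: real and n :: nat and s :: "nat \<Rightarrow> real"
    and \<tau> m :: "nat \<Rightarrow> 'a \<Rightarrow> real"
  assumes levy: "levy_process M X"
    and nonzero: "\<not> (AE \<omega> in M. \<forall>t\<ge>0. X t \<omega> = 0)"
    and theta: "\<theta> > 0"
    and T_nonneg: "\<And>\<omega>. \<omega> \<in> space M \<Longrightarrow> T \<omega> \<ge> 0"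
    and T_exp: "distributed M lborel T (exponential_density \<theta>)"
    and T_indep: "prob_space.indep_var_het M borel T
                    (Pi\<^sub>M {0..} (\<lambda>_. borel)) (\<lambda>\<omega>. \<lambda>t\<in>{0..}. X t \<omega>)"
    and n: "n \<ge> 1"
    and s: "strict_mono_on {1..n} s"
  defines "\<tau> \<equiv> \<lambda>i \<omega>. inf_time (\<lambda>t. subtract_drift X (s i) t \<omega>) (T \<omega>)"
    and "m \<equiv> \<lambda>i \<omega>. running_inf (\<lambda>t. subtract_drift X (s i) t \<omega>) (T \<omega>)"
  shows "prob_space.indep_vars M (\<lambda>_. borel \<Otimes>\<^sub>M borel)
     (\<lambda>i \<omega>.
        if i = 0 then (\<tau> 1 \<omega>, m 1 \<omega> + s 1 * \<tau> 1 \<omega>)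
        else if i = n then (T \<omega> - \<tau> n \<omega>, X (T \<omega>) \<omega> - m n \<omega> - s n * \<tau> n \<omega>)
        else (\<tau> (i + 1) \<omega> - \<tau> i \<omega>,
              m (i + 1) \<omega> - m i \<omega> + s (i + 1) * \<tau> (i + 1) \<omega> - s i * \<tau> i \<omega>))
     {0..n}"
proof -
  interpret levy_process M X by (rule levy)
  interpret levy_exponential_time M X T \<theta>
    using theta T_nonneg T_exp T_indep by unfold_locales
  have "indep_vars (\<lambda>_. borel \<Otimes>\<^sub>M borel) (corner_increment n s) {0..n}"
    using indep_corner_increments[OF s] by (simp add: borel_prod atMost_atLeast0)
  moreover have "corner_increment n s i = (\<lambda>\<omega>.
        if i = 0 then (\<tau> 1 \<omega>, m 1 \<omega> + s 1 * \<tau> 1 \<omega>)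
        else if i = n then (T \<omega> - \<tau> n \<omega>, X (T \<omega>) \<omega> - m n \<omega> - s n * \<tau> n \<omega>)
        else (\<tau> (i + 1) \<omega> - \<tau> i \<omega>,
              m (i + 1) \<omega> - m i \<omega> + s (i + 1) * \<tau> (i + 1) \<omega> - s i * \<tau> i \<omega>))" if "i \<in> {0..n}" for i
    using that n
    by (auto simp: fun_eq_iff corner_increment_def corner_time_def corner_value_def min_time_def
        min_value_def \<tau>_def m_def subtract_drift_def)
  ultimately show ?thesis
    by (subst indep_vars_cong[OF refl _ refl, symmetric]) auto
qed

end
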